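(* Let $x^*$ be a minimizer of $Z(x)=\psi(x,P)$, where $Z$ is twice differentiable, and suppose the following hold. (Optimality) $\nabla Z(x^* )=0$ and the Hessian $\nabla^2 Z(x^* )$ is positive semidefinite. (Linearizability) There exist a function $IF:\Xi\to\mathbb R^d$ with entrywise finite covariance matrix $Cov_P(IF(\xi))$ and a constant vector $K\in\mathbb R^d$ such that $$\hat x_n^\lambda-x^*=\langle IF(\xi),\hat P_n-P\rangle+\lambda K+o_p\left(\frac1{\sqrt n}+|\lambda|\right)$$ as $n\to\infty$ and $\lambda\to0$ (at any rate, i.e., along any sequence $\lambda=\lambda_n\to 0$); moreover $\hat x_n^0=\hat x_n^{EO}$. (Non-degeneracy) $K^\top\nabla^2Z(x^* )K\neq0$. Let $\lambda_n\to0$ as $n\to\infty$. Then $n\mathcal G(\hat x_n^{EO})$ is asymptotically second-order stochastically dominated by $n\mathcal G(\hat x_n^{\lambda_n})$, where $\mathcal G(x)=Z(x)-Z(x^* )$.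
   Context: Setting: $\xi\in\Xi$ is a random object with distribution $P$; the problem is $\min_{x\in\mathcal X}Z(x)$ with $\mathcal X\subset\mathbb R^d$ ($d$ fixed) and $Z(x)=\psi(x,P)$. Data $\xi_1,\xi_2,\ldots$ are i.i.d. from $P$, and $\hat P_n=\frac1n\sum_{i=1}^n\delta_{\xi_i}$ is the empirical distribution. $\hat x_n^{EO}=x(\hat P_n)$ is the empirical optimization (EO) solution, obtained by replacing $P$ by $\hat P_n$ in the objective. $\hat x_n^\lambda=x(\hat P_n,\lambda)$ is a data-driven solution from an expanded procedure with a real tuning parameter $\lambda$, where $\lambda=0$ corresponds to EO. The optimality gap is $\mathcal G(x)=Z(x)-Z(x^* )$. Notation: $\langle IF(\xi),\hat P_n-P\rangle:=\int IF\,d(\hat P_n-P)=\frac1n\sum_{i=1}^n IF(\xi_i)-E_P[IF(\xi)]$. $o_p(b_n)$ denotes a random quantity whose ratio to $b_n$ tends to $0$ in probability. $\Rightarrow$ denotes weak convergence. Second-order stochastic dominance (for losses): for random variables $A,B$, $A$ is second-order stochastically dominated by $B$ if $E[u(A)]\le E[u(B)]$ for every non-decreasing convex $u:\mathbb R\to\mathbb R$. Asymptotic version: a real-valued random sequence $A_n$ is asymptotically second-order stochastically dominated by $B_n$ if $A_n\Rightarrow W_0$ and $B_n\Rightarrow W_1$ with $W_0$ second-order stochastically dominated by $W_1$ or, more generally, if for any subsequences $n_{k_0},n_{k_1}\to\infty$ such that $A_{n_{k_0}}$ and $B_{n_{k_1}}$ have weak limits $W_0$ and $W_1$ respectively, $W_0$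 is second-order stochastically dominated by $W_1$. Weak limits are allowed to be $\pm\infty$, meaning convergence in probability to $\pm\infty$; a limit $W_1=+\infty$ is regarded as dominating every $W_0$. *)

theory Defs
  imports "HOL-Probability.Probability"
begin

section \<open>Smoothness\<close>

definition gradient :: "(real ^ 'd \<Rightarrow> real) \<Rightarrow> real ^ 'd \<Rightarrow> real ^ 'd" where
  "gradient f x = (\<chi> i. frechet_derivative f (at x) (axis i 1))"

definition hessian :: "(real ^ 'd \<Rightarrow> real) \<Rightarrow> real ^ 'd \<Rightarrow> real ^ 'd ^ 'd" where
  "hessian f x = jacobian (gradient f) (at x)"

definition twice_differentiable_on :: "(real ^ 'd \<Rightarrow> real) \<Rightarrow> (real ^ 'd) set \<Rightarrow> bool" where
  "twice_differentiable_on f D \<longleftrightarrow>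
     (\<forall>x\<in>D. f differentiable (at x) \<and> gradient f differentiable (at x))"

text \<open>Symmetry is not part of the definition; it is automatic for the Hessian of a twice
  (totally) differentiable function.\<close>

definition positive_semidefinite :: "real ^ 'd ^ 'd \<Rightarrow> bool" where
  "positive_semidefinite A \<longleftrightarrow> (\<forall>v. 0 \<le> v \<bullet> (A *v v))"


section \<open>Empirical distribution and influence function\<close>

text \<open>The average of the Dirac measures at \<open>\<xi> 0 \<omega>, \<dots>, \<xi> (n - 1) \<omega>\<close>, written as the
  push-forward of the uniform distribution on the indices.  It is a probability measure
  for \<open>n \<ge> 1\<close>.\<close>

definition empirical :: "'a measure \<Rightarrow> (nat \<Rightarrow> 'w \<Rightarrow> 'a) \<Rightarrow> nat \<Rightarrow> 'w \<Rightarrow> 'a measure" where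
  "empirical P \<xi> n \<omega> = distr (uniform_count_measure {..<n}) P (\<lambda>i. \<xi> i \<omega>)"

definition pairing :: "('a \<Rightarrow> real ^ 'd) \<Rightarrow> 'a measure \<Rightarrow> 'a measure \<Rightarrow> real ^ 'd" where
  "pairing f Q P = integral\<^sup>L Q f - integral\<^sup>L P f"

lemma pairing_empirical:
  fixes f :: "'a \<Rightarrow> real ^ 'd"
  assumes f: "f \<in> borel_measurable P" and \<xi>: "\<And>i. \<xi> i \<omega> \<in> space P"
  shows "pairing f (empirical P \<xi> n \<omega>) P
    = (1 / real n) *\<^sub>R (\<Sum>i<n. f (\<xi> i \<omega>)) - integral\<^sup>L P f"
proof -
  have "(\<lambda>i. \<xi> i \<omega>) \<in> uniform_count_measure {..<n} \<rightarrow>\<^sub>M P"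
    using \<xi> by (auto simp: measurable_def space_uniform_count_measure sets_uniform_count_measure)
  then have "integral\<^sup>L (empirical P \<xi> n \<omega>) f
      = integral\<^sup>L (uniform_count_measure {..<n}) (\<lambda>i. f (\<xi> i \<omega>))"
    unfolding empirical_def using f by (rule integral_distr)
  also have "\<dots> = (\<Sum>i<n. (1 / real n) *\<^sub>R f (\<xi> i \<omega>))"
    unfolding uniform_count_measure_def
    by (subst lebesgue_integral_point_measure_finite) auto
  finally show ?thesis
    by (simp add: pairing_def scaleR_sum_right)
qed

definition finite_covariance :: "'a measure \<Rightarrow> ('a \<Rightarrow> real ^ 'd) \<Rightarrow> bool" where
  "finite_covariance P f \<longleftrightarrow> integrable P f \<and>
     (\<forall>i j. integrable P
        (\<lambda>z. (f z $ i - integral\<^sup>L P (\<lambda>z. f z $ i)) * (f z $ j - integral\<^sup>L P (\<lambda>z. f z $ j))))"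

text \<open>\<open>R\<^sub>n = o\<^sub>p(b\<^sub>n)\<close>.\<close>

definition small_o_prob ::
  "'w measure \<Rightarrow> (nat \<Rightarrow> 'w \<Rightarrow> 'b::real_normed_vector) \<Rightarrow> (nat \<Rightarrow> real) \<Rightarrow> bool" where
  "small_o_prob M R b \<longleftrightarrow>
     (\<forall>\<epsilon>>0. (\<lambda>n. measure M {\<omega> \<in> space M. norm (R n \<omega> /\<^sub>R b n) > \<epsilon>}) \<longlonglongrightarrow> 0)"

text \<open>Remainder of the first-order expansion of \<open>xsol (empirical P \<xi> n \<omega>) l\<close> around \<open>xs\<close>.\<close>

definition linear_remainder ::
  "'a measure \<Rightarrow> (nat \<Rightarrow> 'w \<Rightarrow> 'a) \<Rightarrow> ('a measure \<Rightarrow> real \<Rightarrow> real ^ 'd) \<Rightarrow> real ^ 'd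
    \<Rightarrow> ('a \<Rightarrow> real ^ 'd) \<Rightarrow> real ^ 'd \<Rightarrow> nat \<Rightarrow> real \<Rightarrow> 'w \<Rightarrow> real ^ 'd" where
  "linear_remainder P \<xi> xsol xs f K n l \<omega> =
     xsol (empirical P \<xi> n \<omega>) l - xs - (pairing f (empirical P \<xi> n \<omega>) P + l *\<^sub>R K)"


section \<open>Second-order stochastic dominance\<close>

text \<open>Expectation with values in the extended reals; it is meaningful only when the positive and
  negative parts do not both have infinite integral.\<close>

definition has_expectation :: "'w measure \<Rightarrow> ('w \<Rightarrow> real) \<Rightarrow> bool" where
  "has_expectation M f \<longleftrightarrow>
     (\<integral>\<^sup>+ w. ennreal (f w) \<partial>M) \<noteq> \<infinity> \<or> (\<integral>\<^sup>+ w. ennreal (- f w) \<partial>M) \<noteq> \<infinity>"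

definition ext_expectation :: "'w measure \<Rightarrow> ('w \<Rightarrow> real) \<Rightarrow> ereal" where
  "ext_expectation M f =
     enn2ereal (\<integral>\<^sup>+ w. ennreal (f w) \<partial>M) - enn2ereal (\<integral>\<^sup>+ w. ennreal (- f w) \<partial>M)"

text \<open>The convention for losses.  Random variables enter through their laws \<open>\<mu>\<close>, \<open>\<nu>\<close>:
  \<open>E[u(A)]\<close> is the integral of \<open>u\<close> against the law of \<open>A\<close>.  Existence of the expectations is part
  of the relation.\<close>

definition ssd_dominated :: "real measure \<Rightarrow> real measure \<Rightarrow> bool" where
  "ssd_dominated \<mu> \<nu> \<longleftrightarrow>
     (\<forall>u::real \<Rightarrow> real. mono u \<and> convex_on UNIV u \<longrightarrow>
        has_expectation \<mu> u \<and> has_expectation \<nu> u \<and> ext_expectation \<mu> u \<le> ext_expectation \<nu> u)"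

text \<open>Weak limits: a law on the real line, or one of the constants \<open>\<plusminus>\<infinity>\<close>.\<close>

datatype wlimit = Minus_Inf | Law "real measure" | Plus_Inf

fun converges_weakly :: "'w measure \<Rightarrow> (nat \<Rightarrow> 'w \<Rightarrow> real) \<Rightarrow> wlimit \<Rightarrow> bool" where
  "converges_weakly M A Minus_Inf \<longleftrightarrow>
     (\<forall>c. (\<lambda>n. measure M {\<omega> \<in> space M. A n \<omega> < c}) \<longlonglongrightarrow> 1)"
| "converges_weakly M A (Law \<mu>) \<longleftrightarrow>
     real_distribution \<mu> \<and> weak_conv_m (\<lambda>n. distr M borel (A n)) \<mu>"
| "converges_weakly M A Plus_Inf \<longleftrightarrow>
     (\<forall>c. (\<lambda>n. measure M {\<omega> \<in> space M. A n \<omega> > c}) \<longlonglongrightarrow> 1)"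

text \<open>The limit \<open>+\<infinity>\<close> dominates everything; symmetrically, \<open>-\<infinity>\<close> is dominated by everything.\<close>

fun limit_dominated :: "wlimit \<Rightarrow> wlimit \<Rightarrow> bool" where
  "limit_dominated _ Plus_Inf \<longleftrightarrow> True"
| "limit_dominated Minus_Inf _ \<longleftrightarrow> True"
| "limit_dominated (Law \<mu>) (Law \<nu>) \<longleftrightarrow> ssd_dominated \<mu> \<nu>"
| "limit_dominated _ _ \<longleftrightarrow> False"

text \<open>\<open>A\<close> is asymptotically dominated by \<open>B\<close>.  When both sequences converge weakly, this says that
  the limits are ordered, since every subsequence has the same limit.\<close>

definition asymp_ssd_dominated ::
  "'w measure \<Rightarrow> (nat \<Rightarrow> 'w \<Rightarrow> real) \<Rightarrow> (nat \<Rightarrow> 'w \<Rightarrow> real) \<Rightarrow> bool" where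
  "asymp_ssd_dominated M A B \<longleftrightarrow>
     (\<forall>r0 r1 W0 W1. strict_mono (r0 :: nat \<Rightarrow> nat) \<and> strict_mono (r1 :: nat \<Rightarrow> nat) \<and>
        converges_weakly M (\<lambda>k. A (r0 k)) W0 \<and> converges_weakly M (\<lambda>k. B (r1 k)) W1
        \<longrightarrow> limit_dominated W0 W1)"

end

theory Submission
  imports Defs
begin

text \<open>Let \<open>Y\<^sub>n\<close> be \<open>\<surd>n\<close> times the pairing of the influence function with \<open>P\<^sub>n - P\<close>, let \<open>q\<close> be
  the quadratic form of the Hessian and \<open>s\<^sub>n = \<surd>n \<lambda>\<^sub>n\<close>.  By Taylor expansion the scaled gap is
  \<open>q (Y\<^sub>n + s\<^sub>n K) / 2\<close> up to a negligible error.  Along a subsequence with \<open>\<bar>s\<^sub>n\<bar> \<rightarrow> \<infinity>\<close> it tends to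
  \<open>+\<infinity>\<close> because \<open>q K > 0\<close>.  If \<open>s\<^sub>n \<rightarrow> c\<close>, the limit law is that of \<open>q (Y + c K) / 2\<close> with \<open>Y\<close>
  symmetric, and \<open>q (Y + c K) + q (- Y + c K) \<ge> 2 q Y\<close> together with convexity gives dominance.

  No multivariate central limit theorem is needed: \<open>q\<close> is a sum of squares of linear forms, so
  \<open>exp (- k q (y + v) / 2)\<close> is a Gaussian mixture of characters \<open>exp (\<i> t \<bullet> y)\<close>, for which the
  one-dimensional theorem suffices, and Weierstrass approximation in \<open>exp (- q / 2)\<close> does the
  rest.\<close>

section \<open>Quadratic forms and second-order expansion\<close>

text \<open>The law of a limit \<open>Y\<close> is never constructed. Dominance concerns weak limits
  along two unrelated subsequences, whose gaps have no common sample size at which to be compared.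
  Hence, for each bounded test function, its expectation at \<open>q (Y_n + c K) / 2\<close> is
  shown to converge along the whole sequence; integrals against both limit laws are read off from
  such limits, and the two sides can be compared at the same \<open>n\<close>. Symmetry of the
  Gaussian limit enters only as equality of the limits for \<open>Y_n\<close> and
  \<open>- Y_n\<close>. Non-decreasing convex functions may be unbounded, while weak convergence
  speaks of bounded continuous ones. They are cut off at a level \<open>m\<close>; this destroys
  convexity, so the dominating side gets level \<open>2 m\<close>, and monotone convergence removes
  both levels. The remainder is small relative to \<open>1 / sqrt n + |lambda|\<close>, hence after
  scaling relative to \<open>1 + |s_n|\<close>, which is no longer bounded when \<open>s_n\<close>
  escapes; in that regime everything is divided by this factor before the quadratic form is
  estimated.\<close>

lemma psd_bilinear_Cauchy_Schwarz:
  fixes b :: "'a::real_vector \<Rightarrow> 'a \<Rightarrow> real"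
  assumes "bilinear b" and sym: "\<And>x y. b x y = b y x" and psd: "\<And>x. 0 \<le> b x x"
  shows "(b x y)\<^sup>2 \<le> b x x * b y y"
proof -
  have expand: "b (x + t *\<^sub>R y) (x + t *\<^sub>R y) = b x x + 2 * t * b x y + t\<^sup>2 * b y y" for t
    by (simp add: bilinear_ladd[OF assms(1)] bilinear_radd[OF assms(1)] bilinear_lmul[OF assms(1)]
        bilinear_rmul[OF assms(1)] sym[of y x] power2_eq_square algebra_simps)
  have nonneg: "0 \<le> b x x + 2 * t * b x y + t\<^sup>2 * b y y" for t
    using psd[of "x + t *\<^sub>R y"] by (simp add: expand)
  show ?thesis
  proof (cases "b y y = 0")
    case True
    have "b x y = 0"
    proof (rule ccontr)
      assume "b x y \<noteq> 0"
      \<comment> \<open>With \<open>b y y = 0\<close> the expression is affine in \<open>t\<close>;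
        this \<open>t\<close> gives it the value -1.\<close>
      then have "2 * (- (b x x + 1) / (2 * b x y)) * b x y = - (b x x + 1)" by simp
      then show False
        using nonneg[of "- (b x x + 1) / (2 * b x y)"] unfolding True mult_zero_right by linarith
    qed
    then show ?thesis using True by simp
  next
    case False
    then have "b y y > 0" using psd[of y] by simp
    \<comment> \<open>The quadratic in \<open>t\<close> is evaluated at its minimizer.\<close>
    then show ?thesis
      using nonneg[of "- b x y / b y y"] by (simp add: field_simps power2_eq_square)
  qed
qed

text \<open>Gaussian elimination: subtracting \<open>b(x, e)\<^sup>2 / b(e, e)\<close> keeps the form positive semidefinite
  and enlarges its kernel by \<open>e\<close>.\<close>

lemma psd_bilinear_sum_of_squares:
  fixes b :: "'a::euclidean_space \<Rightarrow> 'a \<Rightarrow> real"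
  assumes "bilinear b" and "\<And>x y. b x y = b y x" and "\<And>x. 0 \<le> b x x"
  shows "\<exists>as. \<forall>x. b x x = (\<Sum>a\<leftarrow>as. (a \<bullet> x)\<^sup>2)"
proof -
  \<comment> \<open>\<open>B\<close> holds the basis vectors still to be eliminated; the diagonal of
    the form vanishes at all other basis vectors.\<close>
  have "\<exists>as. \<forall>x. b x x = (\<Sum>a\<leftarrow>as. (a \<bullet> x)\<^sup>2)"
    if "finite B" "bilinear b" "\<And>x y. b x y = b y x" "\<And>x. 0 \<le> b x x" "\<forall>e\<in>Basis - B. b e e = 0"
    for B and b :: "'a \<Rightarrow> 'a \<Rightarrow> real"
    using that
  proof (induction B arbitrary: b rule: finite_induct)
    case empty
    \<comment> \<open>By Cauchy-Schwarz a zero diagonal entry puts the vector into the kernel, so a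
      zero diagonal on the whole basis forces the zero form.\<close>
    have ker: "b e x = 0" if "e \<in> Basis" for e x
      using psd_bilinear_Cauchy_Schwarz[OF empty(1-3), of e x] empty(4) that by simp
    have "b x x = 0" for x
    proof -
      have "b x x = b (\<Sum>e\<in>Basis. (x \<bullet> e) *\<^sub>R e) x"
        by (simp add: euclidean_representation)
      also have "\<dots> = (\<Sum>e\<in>Basis. (x \<bullet> e) *\<^sub>R b e x)"
        using empty(1) unfolding bilinear_def
        by (simp add: linear_sum[of "\<lambda>y. b y x"] linear_scale[of "\<lambda>y. b y x"])
      finally show ?thesis using ker by simp
    qed
    then show ?case by (intro exI[of _ "[]"]) simp
  next
    case (insert e B)
    note lin = bilinear_ladd[OF insert.prems(1)] bilinear_radd[OF insert.prems(1)]
      bilinear_lmul[OF insert.prems(1)] bilinear_rmul[OF insert.prems(1)]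
    show ?case
    proof (cases "b e e = 0")
      case True
      with insert.prems show ?thesis by (intro insert.IH) auto
    next
      case False
      then have pos: "b e e > 0" using insert.prems(3)[of e] by simp
      define c where "c x y = b x y - b x e * b y e / b e e" for x y
      have "bilinear c"
        unfolding bilinear_def c_def
        by (auto intro!: linearI simp: lin algebra_simps add_divide_distrib)
      moreover have "c x y = c y x" for x y
        using insert.prems(2)[of x y] by (simp add: c_def)
      moreover have c_nonneg: "0 \<le> c x x" for x
        using psd_bilinear_Cauchy_Schwarz[OF insert.prems(1-3), of x e] pos
        by (simp add: c_def field_simps power2_eq_square)
      \<comment> \<open>At \<open>e\<close> this holds by construction. At other vectors outside
        \<open>B\<close> the diagonal was already 0, subtracting a square cannot raise it, and
        \<open>c\<close> is nonnegative.\<close>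
      moreover have "c f f = 0" if "f \<in> Basis - B" for f
      proof (cases "f = e")
        case True
        then show ?thesis using pos by (simp add: c_def)
      next
        case False
        then have "b f f = 0" using insert.prems(4) that by auto
        then have "c f f \<le> 0" using pos by (simp add: c_def zero_le_mult_iff)
        then show ?thesis using c_nonneg[of f] by simp
      qed
      ultimately obtain as where as: "\<And>x. c x x = (\<Sum>a\<leftarrow>as. (a \<bullet> x)\<^sup>2)"
        using insert.IH[of c] by auto
      \<comment> \<open>\<open>a\<close> represents the linear functional
        \<open>b x e / sqrt (b e e)\<close>, whose square is the term subtracted in
        \<open>c\<close>.\<close>
      define a where "a = (\<Sum>i\<in>Basis. (b i e / sqrt (b e e)) *\<^sub>R i)"
      have "(a \<bullet> x)\<^sup>2 = b x e * b x e / b e e" for x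
      proof -
        have "b x e = b (\<Sum>i\<in>Basis. (x \<bullet> i) *\<^sub>R i) e"
          by (simp add: euclidean_representation)
        also have "\<dots> = (\<Sum>i\<in>Basis. (x \<bullet> i) *\<^sub>R b i e)"
          using insert.prems(1) unfolding bilinear_def
          by (simp add: linear_sum[of "\<lambda>y. b y e"] linear_scale[of "\<lambda>y. b y e"])
        finally have "a \<bullet> x = b x e / sqrt (b e e)"
          by (simp add: a_def inner_sum_left sum_divide_distrib inner_commute[of x] mult.commute)
        then show ?thesis using pos by (simp add: power_divide power2_eq_square)
      qed
      then have "b x x = (\<Sum>a\<leftarrow>a # as. (a \<bullet> x)\<^sup>2)" for x
        using as[of x] by (simp add: c_def)
      then show ?thesis by blast
    qed
  qed
  from this[of Basis b] assms show ?thesis by simp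
qed

text \<open>Elimination works on symmetric forms; passing to the symmetric part of \<open>H\<close>
  leaves the quadratic form unchanged.\<close>

lemma psd_matrix_sum_of_squares:
  fixes H :: "real ^ 'd ^ 'd"
  assumes "positive_semidefinite H"
  shows "\<exists>as. \<forall>v. v \<bullet> (H *v v) = (\<Sum>a\<leftarrow>as. (a \<bullet> v)\<^sup>2)"
proof -
  define b where "b x y = (x \<bullet> (H *v y) + y \<bullet> (H *v x)) / 2" for x y :: "real ^ 'd"
  have "bilinear b"
    unfolding bilinear_def b_def
    by (auto intro!: linearI simp: matrix_vector_right_distrib inner_add_left inner_add_right
        matrix_vector_mult_scaleR algebra_simps add_divide_distrib)
  moreover have "b x y = b y x" for x y by (simp add: b_def)
  moreover have b: "b x x = x \<bullet> (H *v x)" for x by (simp add: b_def)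
  moreover have "0 \<le> b x x" for x using assms by (simp add: b positive_semidefinite_def)
  ultimately show ?thesis using psd_bilinear_sum_of_squares[of b] by auto
qed

section \<open>Second-order expansion at a critical point\<close>

lemma has_derivative_gradient:
  assumes "f differentiable (at x)"
  shows "(f has_derivative (\<lambda>h. gradient f x \<bullet> h)) (at x)"
proof -
  let ?f' = "frechet_derivative f (at x)"
  have f': "(f has_derivative ?f') (at x)"
    using assms by (simp add: frechet_derivative_works)
  then have lin: "linear ?f'" by (rule has_derivative_linear)
  have "?f' h = gradient f x \<bullet> h" for h
  proof -
    have "?f' h = ?f' (\<Sum>i\<in>UNIV. h $ i *\<^sub>R axis i 1)"
      by (simp add: basis_expansion scalar_mult_eq_scaleR[symmetric])
    also have "\<dots> = gradient f x \<bullet> h"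
      using lin by (simp add: linear_sum linear_scale gradient_def inner_vec_def mult.commute)
    finally show ?thesis .
  qed
  then show ?thesis using f' by (metis (no_types, lifting) ext)
qed

text \<open>The Hessian is not assumed continuous, so a remainder with the Hessian at an
  intermediate point would be of no help. Instead the mean value theorem is applied once, to
  \<open>f\<close> minus its quadratic model along the segment; the derivative of that difference is
  the error of linearizing the gradient at \<open>x\<^sub>0\<close>, paired with
  \<open>v\<close>.\<close>

lemma second_order_Taylor_Peano:
  fixes f :: "real ^ 'd \<Rightarrow> real"
  assumes "open D" "x\<^sub>0 \<in> D" "twice_differentiable_on f D" "gradient f x\<^sub>0 = 0" "\<epsilon> > 0"
  shows "\<exists>\<delta>>0. \<forall>x. norm (x - x\<^sub>0) < \<delta> \<longrightarrow>
    \<bar>f x - f x\<^sub>0 - (x - x\<^sub>0) \<bullet> (hessian f x\<^sub>0 *v (x - x\<^sub>0)) / 2\<bar> \<le> \<epsilon> * (norm (x - x\<^sub>0))\<^sup>2"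
proof -
  let ?H = "hessian f x\<^sub>0"
  have diff: "f differentiable (at x)" if "x \<in> D" for x
    using assms(3) that by (auto simp: twice_differentiable_on_def)
  have "(gradient f has_derivative (\<lambda>h. ?H *v h)) (at x\<^sub>0)"
    using assms(2,3) jacobian_works unfolding twice_differentiable_on_def hessian_def by blast
  then obtain d where "d > 0" and
    d: "\<And>y. norm (y - x\<^sub>0) < d \<Longrightarrow>
      norm (gradient f y - gradient f x\<^sub>0 - ?H *v (y - x\<^sub>0)) \<le> \<epsilon> * norm (y - x\<^sub>0)"
    using \<open>\<epsilon> > 0\<close> unfolding has_derivative_at_alt by blast
  obtain d' where "d' > 0" and d': "ball x\<^sub>0 d' \<subseteq> D"
    using assms(1,2) openE by blast
  show ?thesis
  proof (intro exI[of _ "min d d'"] conjI allI impI)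
    show "min d d' > 0" using \<open>d > 0\<close> \<open>d' > 0\<close> by simp
    fix x assume x: "norm (x - x\<^sub>0) < min d d'"
    define v where "v = x - x\<^sub>0"
    define \<phi> where "\<phi> t = f (x\<^sub>0 + t *\<^sub>R v) - t\<^sup>2 / 2 * (v \<bullet> (?H *v v))" for t :: real
    define \<phi>' where "\<phi>' t = gradient f (x\<^sub>0 + t *\<^sub>R v) \<bullet> v - t * (v \<bullet> (?H *v v))" for t :: real
    have small: "norm (t *\<^sub>R v) < min d d'" if "0 \<le> t" "t \<le> 1" for t
    proof -
      have "norm (t *\<^sub>R v) \<le> 1 * norm v"
        unfolding norm_scaleR using that by (intro mult_right_mono) auto
      then show ?thesis using x by (simp add: v_def)
    qed
    have "(\<phi> has_derivative (\<lambda>h. \<phi>' t * h)) (at t within {0..1})" if "0 \<le> t" "t \<le> 1" for t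
    proof -
      have "x\<^sub>0 + t *\<^sub>R v \<in> D"
        using small[OF that] d' by (auto simp: dist_norm)
      then have "(f has_derivative (\<lambda>h. gradient f (x\<^sub>0 + t *\<^sub>R v) \<bullet> h)) (at (x\<^sub>0 + t *\<^sub>R v))"
        by (intro has_derivative_gradient diff)
      moreover have "((\<lambda>t. x\<^sub>0 + t *\<^sub>R v) has_derivative (\<lambda>h. h *\<^sub>R v)) (at t within {0..1})"
        by (auto intro!: derivative_eq_intros)
      ultimately have "((\<lambda>t. f (x\<^sub>0 + t *\<^sub>R v)) has_derivative
          (\<lambda>h. gradient f (x\<^sub>0 + t *\<^sub>R v) \<bullet> (h *\<^sub>R v))) (at t within {0..1})"
        by (rule has_derivative_compose[rotated])
      then show ?thesis
        unfolding \<phi>_def \<phi>'_def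
        by (auto intro!: derivative_eq_intros simp: algebra_simps power2_eq_square)
    qed
    from mvt_very_simple[OF zero_le_one this]
    obtain t where t: "0 \<le> t" "t \<le> 1" and mvt: "\<phi> 1 - \<phi> 0 = \<phi>' t"
      by auto
    have "\<phi>' t = (gradient f (x\<^sub>0 + t *\<^sub>R v) - gradient f x\<^sub>0 - ?H *v (t *\<^sub>R v)) \<bullet> v"
      using assms(4)
      by (simp add: \<phi>'_def inner_diff_left matrix_vector_mult_scaleR inner_commute[of v])
    also have "\<bar>\<dots>\<bar> \<le> norm (gradient f (x\<^sub>0 + t *\<^sub>R v) - gradient f x\<^sub>0 - ?H *v (t *\<^sub>R v)) * norm v"
      by (rule Cauchy_Schwarz_ineq2)
    also have "\<dots> \<le> (\<epsilon> * norm (t *\<^sub>R v)) * norm v"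
      using d[of "x\<^sub>0 + t *\<^sub>R v"] small[OF t] by (intro mult_right_mono) auto
    also have "\<dots> = t * (\<epsilon> * (norm v)\<^sup>2)"
      using t by (simp add: power2_eq_square)
    also have "\<dots> \<le> 1 * (\<epsilon> * (norm v)\<^sup>2)"
      using t \<open>\<epsilon> > 0\<close> by (intro mult_right_mono) auto
    finally have "\<bar>\<phi> 1 - \<phi> 0\<bar> \<le> \<epsilon> * (norm v)\<^sup>2" using mvt by simp
    moreover have "\<phi> 1 - \<phi> 0 = f x - f x\<^sub>0 - v \<bullet> (?H *v v) / 2"
      by (simp add: \<phi>_def v_def)
    ultimately show "\<bar>f x - f x\<^sub>0 - (x - x\<^sub>0) \<bullet> (?H *v (x - x\<^sub>0)) / 2\<bar> \<le> \<epsilon> * (norm (x - x\<^sub>0))\<^sup>2"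
      by (simp add: v_def)
  qed
qed

lemma uniformly_close_on_cball:
  fixes q :: "'a::euclidean_space \<Rightarrow> real"
  assumes "continuous_on UNIV q" "\<epsilon> > 0"
  shows "\<exists>\<eta>>0. \<forall>v w. norm v \<le> R \<and> norm w \<le> R \<and> norm (w - v) < \<eta> \<longrightarrow> \<bar>q w - q v\<bar> < \<epsilon>"
proof -
  have "uniformly_continuous_on (cball 0 R) q"
    using assms(1) by (intro compact_uniformly_continuous continuous_on_subset[OF assms(1)]) auto
  then obtain \<eta> where "\<eta> > 0" "\<And>v w. v \<in> cball 0 R \<Longrightarrow> w \<in> cball 0 R \<Longrightarrow> dist w v < \<eta> \<Longrightarrow> dist (q w) (q v) < \<epsilon>"
    using \<open>\<epsilon> > 0\<close> unfolding uniformly_continuous_on_def by metis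
  then show ?thesis by (intro exI[of _ \<eta>]) (auto simp: dist_norm)
qed

section \<open>Deterministic estimates for the scaled gap\<close>

context
  fixes Z :: "'a::euclidean_space \<Rightarrow> real" and q :: "'a \<Rightarrow> real" and x\<^sub>0 K :: 'a
  assumes Taylor: "\<And>\<epsilon>. \<epsilon> > 0 \<Longrightarrow> \<exists>\<delta>>0. \<forall>x. norm (x - x\<^sub>0) < \<delta> \<longrightarrow>
      \<bar>Z x - Z x\<^sub>0 - q (x - x\<^sub>0) / 2\<bar> \<le> \<epsilon> * (norm (x - x\<^sub>0))\<^sup>2"
    and q_scale: "\<And>t v. q (t *\<^sub>R v) = t\<^sup>2 * q v"
    and q_cont: "continuous_on UNIV q"
begin

text \<open>Here \<open>y\<close> stands for the normalized sum, \<open>e\<close> for the rescaled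
  remainder and \<open>s\<close> for \<open>sqrt n\<close> times the tuning parameter. Because the
  bound is uniform over balls in \<open>y\<close> and \<open>e\<close>, probability later enters
  only through the chance of leaving these balls.\<close>

lemma scaled_gap_near_quadratic:
  fixes N s :: "nat \<Rightarrow> real"
  assumes N: "filterlim N at_top sequentially" and s: "s \<longlonglongrightarrow> c" and "R > 0" "\<epsilon> > 0"
  shows "\<exists>\<delta>>0. \<forall>\<^sub>F k in sequentially. \<forall>x y e. norm y \<le> R \<and> norm e \<le> \<delta> \<and>
      sqrt (N k) *\<^sub>R (x - x\<^sub>0) = y + s k *\<^sub>R K + (1 + \<bar>s k\<bar>) *\<^sub>R e \<longrightarrow>
      \<bar>N k * (Z x - Z x\<^sub>0) - q (y + c *\<^sub>R K) / 2\<bar> < \<epsilon>"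
proof -
  \<comment> \<open>\<open>R'\<close> bounds both \<open>y + c K\<close> and the full right-hand
    side: eventually \<open>|s k| \<le> |c| + 1\<close>, and \<open>\<delta> \<le> 1\<close> keeps
    the remainder term below \<open>|c| + 2\<close>.\<close>
  define R' where "R' = R + (\<bar>c\<bar> + 1) * norm K + (\<bar>c\<bar> + 2)"
  have "R' > 0" using \<open>R > 0\<close> unfolding R'_def by (intro add_pos_pos add_pos_nonneg) auto
  obtain \<eta> where "\<eta> > 0" and
    \<eta>: "\<And>v w. norm v \<le> R' \<Longrightarrow> norm w \<le> R' \<Longrightarrow> norm (w - v) < \<eta> \<Longrightarrow> \<bar>q w - q v\<bar> < \<epsilon>"
    using uniformly_close_on_cball[OF q_cont \<open>\<epsilon> > 0\<close>, of R'] by blast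
  \<comment> \<open>The error budget: the Taylor error multiplied by \<open>N k\<close> is at most
    \<open>\<epsilon>' * R'\<^sup>2 = \<epsilon> / 2\<close>, and replacing the argument of
    \<open>q / 2\<close> costs less than the other half.\<close>
  define \<epsilon>' where "\<epsilon>' = \<epsilon> / (2 * R'\<^sup>2)"
  have "\<epsilon>' > 0" using \<open>\<epsilon> > 0\<close> \<open>R' > 0\<close> by (simp add: \<epsilon>'_def)
  obtain d where "d > 0" and
    d: "\<And>x. norm (x - x\<^sub>0) < d \<Longrightarrow>
      \<bar>Z x - Z x\<^sub>0 - q (x - x\<^sub>0) / 2\<bar> \<le> \<epsilon>' * (norm (x - x\<^sub>0))\<^sup>2"
    using Taylor[OF \<open>\<epsilon>' > 0\<close>] by blast
  \<comment> \<open>The remainder may move the argument of \<open>q\<close> by at most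
    \<open>\<eta> / 2\<close>; the difference \<open>s k - c\<close> accounts for the rest.\<close>
  define \<delta> where "\<delta> = min 1 (\<eta> / (2 * (\<bar>c\<bar> + 2)))"
  have "\<delta> > 0" "\<delta> \<le> 1" using \<open>\<eta> > 0\<close> by (auto simp: \<delta>_def)
  have \<delta>: "(\<bar>c\<bar> + 2) * \<delta> \<le> \<eta> / 2"
  proof -
    have "(\<bar>c\<bar> + 2) * \<delta> \<le> (\<bar>c\<bar> + 2) * (\<eta> / (2 * (\<bar>c\<bar> + 2)))"
      unfolding \<delta>_def by (intro mult_left_mono) auto
    also have "\<dots> = \<eta> / 2" by (simp add: divide_simps)
    finally show ?thesis .
  qed
  have "(\<lambda>k. \<bar>s k - c\<bar>) \<longlonglongrightarrow> 0"
    using s by (simp add: LIM_zero_iff tendsto_rabs_zero)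
  from order_tendstoD(2)[OF this zero_less_one]
  have ev1: "\<forall>\<^sub>F k in sequentially. \<bar>s k - c\<bar> < 1" by simp
  have "(\<lambda>k. \<bar>s k - c\<bar> * norm K) \<longlonglongrightarrow> 0"
    using \<open>(\<lambda>k. \<bar>s k - c\<bar>) \<longlonglongrightarrow> 0\<close> by (rule tendsto_mult_left_zero)
  from order_tendstoD(2)[OF this, of "\<eta> / 2"] \<open>\<eta> > 0\<close>
  have ev2: "\<forall>\<^sub>F k in sequentially. \<bar>s k - c\<bar> * norm K < \<eta> / 2" by simp
  have ev3: "\<forall>\<^sub>F k in sequentially. N k > max 0 ((R' / d)\<^sup>2)"
    using N unfolding filterlim_at_top_dense by blast
  show ?thesis
  proof (intro exI[of _ \<delta>] conjI)
    show "\<delta> > 0" by fact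
    show "\<forall>\<^sub>F k in sequentially. \<forall>x y e. norm y \<le> R \<and> norm e \<le> \<delta> \<and>
      sqrt (N k) *\<^sub>R (x - x\<^sub>0) = y + s k *\<^sub>R K + (1 + \<bar>s k\<bar>) *\<^sub>R e \<longrightarrow>
      \<bar>N k * (Z x - Z x\<^sub>0) - q (y + c *\<^sub>R K) / 2\<bar> < \<epsilon>"
      using ev1 ev2 ev3
    proof (eventually_elim, intro allI impI, elim conjE)
      fix k x y e
      assume k1: "\<bar>s k - c\<bar> < 1" and k2: "\<bar>s k - c\<bar> * norm K < \<eta> / 2"
        and Nk: "max 0 ((R' / d)\<^sup>2) < N k"
        and y: "norm y \<le> R" and e: "norm e \<le> \<delta>"
        and eq: "sqrt (N k) *\<^sub>R (x - x\<^sub>0) = y + s k *\<^sub>R K + (1 + \<bar>s k\<bar>) *\<^sub>R e" (is "_ = ?w")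
      have s_le: "\<bar>s k\<bar> \<le> \<bar>c\<bar> + 1" using k1 by linarith
      have "norm (s k *\<^sub>R K) \<le> (\<bar>c\<bar> + 1) * norm K"
        using s_le by (simp add: mult_right_mono)
      moreover have ebd: "norm ((1 + \<bar>s k\<bar>) *\<^sub>R e) \<le> (\<bar>c\<bar> + 2) * \<delta>"
        unfolding norm_scaleR using s_le e by (intro mult_mono) auto
      moreover have "(\<bar>c\<bar> + 2) * \<delta> \<le> \<bar>c\<bar> + 2"
        using \<open>\<delta> \<le> 1\<close> mult_left_mono[of \<delta> 1 "\<bar>c\<bar> + 2"] by simp
      ultimately have w: "norm ?w \<le> R'"
        using norm_triangle_ineq[of "y + s k *\<^sub>R K" "(1 + \<bar>s k\<bar>) *\<^sub>R e"]
          norm_triangle_ineq[of y "s k *\<^sub>R K"] y unfolding R'_def by linarith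
      have "norm (c *\<^sub>R K) \<le> (\<bar>c\<bar> + 1) * norm K"
        by (simp add: mult_right_mono)
      then have v: "norm (y + c *\<^sub>R K) \<le> R'"
        using norm_triangle_ineq[of y "c *\<^sub>R K"] y unfolding R'_def by linarith
      have "?w - (y + c *\<^sub>R K) = (s k - c) *\<^sub>R K + (1 + \<bar>s k\<bar>) *\<^sub>R e"
        by (simp add: algebra_simps)
      then have "norm (?w - (y + c *\<^sub>R K)) \<le> \<bar>s k - c\<bar> * norm K + norm ((1 + \<bar>s k\<bar>) *\<^sub>R e)"
        by (metis norm_triangle_ineq norm_scaleR)
      then have "norm (?w - (y + c *\<^sub>R K)) < \<eta>" using ebd \<delta> k2 by linarith
      then have close: "\<bar>q ?w - q (y + c *\<^sub>R K)\<bar> < \<epsilon>" using \<eta>[OF v w] by simp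
      have "N k > 0" using Nk by (rule le_less_trans[OF max.cobounded1])
      have "R' / d < sqrt (N k)" using Nk by (intro real_less_rsqrt) simp
      have x: "x - x\<^sub>0 = (1 / sqrt (N k)) *\<^sub>R ?w"
        unfolding eq[symmetric] using \<open>N k > 0\<close> by simp
      then have "norm (x - x\<^sub>0) = norm ?w / sqrt (N k)" using \<open>N k > 0\<close> by simp
      also have "\<dots> \<le> R' / sqrt (N k)" using w \<open>N k > 0\<close> by (intro divide_right_mono) auto
      also have "\<dots> < d"
        using \<open>R' / d < sqrt (N k)\<close> \<open>N k > 0\<close> \<open>d > 0\<close> by (simp add: field_simps)
      finally have "\<bar>Z x - Z x\<^sub>0 - q (x - x\<^sub>0) / 2\<bar> \<le> \<epsilon>' * (norm (x - x\<^sub>0))\<^sup>2" by (rule d)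
      then have "N k * \<bar>Z x - Z x\<^sub>0 - q (x - x\<^sub>0) / 2\<bar> \<le> N k * (\<epsilon>' * (norm (x - x\<^sub>0))\<^sup>2)"
        using \<open>N k > 0\<close> by (intro mult_left_mono) auto
      also have "N k * (\<epsilon>' * (norm (x - x\<^sub>0))\<^sup>2) = \<epsilon>' * (norm ?w)\<^sup>2"
        unfolding x using \<open>N k > 0\<close> by (simp add: power_divide)
      also have "\<dots> \<le> \<epsilon>' * R'\<^sup>2"
        using w \<open>\<epsilon>' > 0\<close> by (intro mult_left_mono power_mono) auto
      also have "\<dots> = \<epsilon> / 2" using \<open>R' > 0\<close> by (simp add: \<epsilon>'_def)
      also have "N k * \<bar>Z x - Z x\<^sub>0 - q (x - x\<^sub>0) / 2\<bar> = \<bar>N k * (Z x - Z x\<^sub>0) - q ?w / 2\<bar>"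
      proof -
        have "q (x - x\<^sub>0) = q ?w / N k"
          unfolding x q_scale using \<open>N k > 0\<close> by (simp add: power_divide)
        then have "N k * (Z x - Z x\<^sub>0) - q ?w / 2 = N k * (Z x - Z x\<^sub>0 - q (x - x\<^sub>0) / 2)"
          using \<open>N k > 0\<close> by (simp add: right_diff_distrib)
        then show ?thesis using \<open>N k > 0\<close> by (simp only: abs_mult abs_of_pos)
      qed
      finally show "\<bar>N k * (Z x - Z x\<^sub>0) - q (y + c *\<^sub>R K) / 2\<bar> < \<epsilon>"
        using close by linarith
    qed
  qed
qed

text \<open>Factoring out \<open>r = 1 + |s k|\<close> leaves a vector \<open>T\<close> close to
  \<open>(s k / r) K\<close>, and \<open>|s k| / r\<close> is at least 1/2. So \<open>q T\<close>
  stays above a positive multiple of \<open>q K\<close>, while the scaled gap is of order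
  \<open>r\<^sup>2 * q T / 2\<close>.\<close>

lemma scaled_gap_unbounded:
  fixes N l :: "nat \<Rightarrow> real"
  defines "s \<equiv> \<lambda>k. sqrt (N k) * l k"
  assumes N: "filterlim N at_top sequentially" and l: "l \<longlonglongrightarrow> 0"
    and s: "filterlim (\<lambda>k. \<bar>s k\<bar>) at_top sequentially" and "R > 0" and qK: "q K > 0"
  shows "\<exists>\<delta>>0. \<forall>\<^sub>F k in sequentially. \<forall>x y e. norm y \<le> R \<and> norm e \<le> \<delta> \<and>
      sqrt (N k) *\<^sub>R (x - x\<^sub>0) = y + s k *\<^sub>R K + (1 + \<bar>s k\<bar>) *\<^sub>R e \<longrightarrow>
      N k * (Z x - Z x\<^sub>0) > C"
proof -
  define R' where "R' = R + norm K + 1"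
  have "R' > 0" using \<open>R > 0\<close> unfolding R'_def by (intro add_pos_nonneg add_pos_pos) auto
  obtain \<eta> where "\<eta> > 0" and
    \<eta>: "\<And>v w. norm v \<le> R' \<Longrightarrow> norm w \<le> R' \<Longrightarrow> norm (w - v) < \<eta> \<Longrightarrow> \<bar>q w - q v\<bar> < q K / 8"
    using uniformly_close_on_cball[OF q_cont, of "q K / 8" R'] qK by auto
  \<comment> \<open>Since \<open>q T / 2\<close> will be at least \<open>q K / 16\<close>, an error
    of at most \<open>q K / 32\<close> leaves \<open>q K / 32\<close>.\<close>
  define \<epsilon>' where "\<epsilon>' = q K / (32 * R'\<^sup>2)"
  have "\<epsilon>' > 0" using qK \<open>R' > 0\<close> by (simp add: \<epsilon>'_def)
  obtain d where "d > 0" and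
    d: "\<And>x. norm (x - x\<^sub>0) < d \<Longrightarrow>
      \<bar>Z x - Z x\<^sub>0 - q (x - x\<^sub>0) / 2\<bar> \<le> \<epsilon>' * (norm (x - x\<^sub>0))\<^sup>2"
    using Taylor[OF \<open>\<epsilon>' > 0\<close>] by blast
  define \<delta> where "\<delta> = min 1 (\<eta> / 2)"
  have "\<delta> > 0" "\<delta> \<le> 1" "\<delta> \<le> \<eta> / 2" using \<open>\<eta> > 0\<close> by (auto simp: \<delta>_def)
  \<comment> \<open>The three thresholds give, in turn, \<open>|s k| / r \<ge> 1 / 2\<close>, a
    contribution of \<open>y / r\<close> below \<open>\<eta> / 2\<close>, and
    \<open>r * (q K / 32)\<close> above \<open>|C|\<close>.\<close>
  define m where "m = Max {1, 2 * R / \<eta>, 32 * \<bar>C\<bar> / q K}"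
  have ev1: "\<forall>\<^sub>F k in sequentially. \<bar>s k\<bar> > m"
    using s unfolding filterlim_at_top_dense by blast
  have ev2: "\<forall>\<^sub>F k in sequentially. N k > 0"
    using N unfolding filterlim_at_top_dense by blast
  \<comment> \<open>The distance to \<open>x\<^sub>0\<close> is of order
    \<open>r / sqrt (N k) = 1 / sqrt (N k) + |l k|\<close>. Although \<open>s\<close> is unbounded,
    \<open>l\<close> tends to 0, and this keeps the point where the Taylor bound is valid.\<close>
  have "(\<lambda>k. 1 / sqrt (N k)) \<longlonglongrightarrow> 0"
    using filterlim_compose[OF sqrt_at_top N]
    by (rule tendsto_divide_0[OF tendsto_const filterlim_at_top_imp_at_infinity])
  then have "(\<lambda>k. (1 / sqrt (N k) + \<bar>l k\<bar>) * R') \<longlonglongrightarrow> (0 + 0) * R'"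
    using l by (intro tendsto_intros) (simp_all add: tendsto_rabs_zero)
  then have ev3: "\<forall>\<^sub>F k in sequentially. (1 / sqrt (N k) + \<bar>l k\<bar>) * R' < d"
    using order_tendstoD(2)[of _ "0::real"] \<open>d > 0\<close> by fastforce
  show ?thesis
  proof (intro exI[of _ \<delta>] conjI)
    show "\<delta> > 0" by fact
    show "\<forall>\<^sub>F k in sequentially. \<forall>x y e. norm y \<le> R \<and> norm e \<le> \<delta> \<and>
      sqrt (N k) *\<^sub>R (x - x\<^sub>0) = y + s k *\<^sub>R K + (1 + \<bar>s k\<bar>) *\<^sub>R e \<longrightarrow>
      N k * (Z x - Z x\<^sub>0) > C"
      using ev1 ev2 ev3
    proof (eventually_elim, intro allI impI, elim conjE)
      fix k x y e
      assume sk: "m < \<bar>s k\<bar>" and Nk: "0 < N k" and k3: "(1 / sqrt (N k) + \<bar>l k\<bar>) * R' < d"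
        and y: "norm y \<le> R" and e: "norm e \<le> \<delta>"
        and eq: "sqrt (N k) *\<^sub>R (x - x\<^sub>0) = y + s k *\<^sub>R K + (1 + \<bar>s k\<bar>) *\<^sub>R e"
      define r where "r = 1 + \<bar>s k\<bar>"
      have m: "1 \<le> m" "2 * R / \<eta> \<le> m" "32 * \<bar>C\<bar> / q K \<le> m" by (auto simp: m_def)
      then have sk': "1 \<le> \<bar>s k\<bar>" "2 * R / \<eta> < r" "32 * \<bar>C\<bar> / q K < r" "r > 0" "r \<ge> 1"
        using sk by (auto simp: r_def)
      define T where "T = (1 / r) *\<^sub>R y + (s k / r) *\<^sub>R K + e"
      define a where "a = (s k / r) *\<^sub>R K"
      have x: "x - x\<^sub>0 = (r / sqrt (N k)) *\<^sub>R T"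
      proof -
        have "sqrt (N k) *\<^sub>R (x - x\<^sub>0) = r *\<^sub>R T"
          unfolding eq T_def using \<open>r > 0\<close> by (simp add: scaleR_add_right r_def)
        then have "(1 / sqrt (N k)) *\<^sub>R (sqrt (N k) *\<^sub>R (x - x\<^sub>0)) = (r / sqrt (N k)) *\<^sub>R T"
          by simp
        then show ?thesis using Nk by simp
      qed
      have sr: "\<bar>s k / r\<bar> \<le> 1" using \<open>r > 0\<close> by (simp add: r_def)
      then have na: "norm a \<le> norm K"
        unfolding a_def norm_scaleR by (intro mult_left_le_one_le) auto
      have yr: "norm ((1 / r) *\<^sub>R y) \<le> R / r"
        using y \<open>r > 0\<close> by (simp add: divide_right_mono)
      moreover have "R / r \<le> R" using \<open>R > 0\<close> \<open>r \<ge> 1\<close> by (simp add: field_simps)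
      ultimately have T: "norm T \<le> R'"
        using norm_triangle_ineq[of "(1 / r) *\<^sub>R y + a" e] norm_triangle_ineq[of "(1 / r) *\<^sub>R y" a]
          na e \<open>\<delta> \<le> 1\<close> unfolding T_def R'_def a_def[symmetric] by linarith
      have a: "norm a \<le> R'" using na \<open>R > 0\<close> by (simp add: R'_def)
      have "T - a = (1 / r) *\<^sub>R y + e" by (simp add: T_def a_def)
      then have "norm (T - a) \<le> norm ((1 / r) *\<^sub>R y) + norm e"
        by (metis norm_triangle_ineq)
      moreover have "R / r < \<eta> / 2"
        using sk'(2) \<open>r > 0\<close> \<open>\<eta> > 0\<close> by (simp add: field_simps)
      ultimately have "norm (T - a) < \<eta>"
        using yr e \<open>\<delta> \<le> \<eta> / 2\<close> by linarith
      then have "\<bar>q T - q a\<bar> < q K / 8" by (rule \<eta>[OF a T])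
      moreover have "q a \<ge> q K / 4"
      proof -
        have "1 / 2 \<le> \<bar>s k / r\<bar>" using sk'(1) by (simp add: r_def)
        then have "(1 / 2)\<^sup>2 \<le> (s k / r)\<^sup>2" by (simp add: abs_le_square_iff[symmetric] del: abs_divide)
        then show ?thesis
          using mult_right_mono[of "(1 / 2)\<^sup>2" "(s k / r)\<^sup>2" "q K"] qK
          by (simp add: a_def q_scale power_divide)
      qed
      ultimately have qT: "q T / 2 \<ge> q K / 16" by linarith
      have rN: "r / sqrt (N k) = 1 / sqrt (N k) + \<bar>l k\<bar>"
        using Nk by (simp add: r_def s_def abs_mult add_divide_distrib)
      have "norm (x - x\<^sub>0) = r / sqrt (N k) * norm T"
        unfolding x using \<open>r > 0\<close> Nk by simp
      also have "\<dots> \<le> r / sqrt (N k) * R'"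
        using T \<open>r > 0\<close> Nk by (intro mult_left_mono) auto
      also have "\<dots> < d" using k3 rN by simp
      finally have "\<bar>Z x - Z x\<^sub>0 - q (x - x\<^sub>0) / 2\<bar> \<le> \<epsilon>' * (norm (x - x\<^sub>0))\<^sup>2" by (rule d)
      then have "Z x - Z x\<^sub>0 \<ge> q (x - x\<^sub>0) / 2 - \<epsilon>' * (norm (x - x\<^sub>0))\<^sup>2" by linarith
      also have "q (x - x\<^sub>0) / 2 - \<epsilon>' * (norm (x - x\<^sub>0))\<^sup>2
          = r\<^sup>2 / N k * (q T / 2 - \<epsilon>' * (norm T)\<^sup>2)"
        unfolding x q_scale using Nk by (simp add: power_divide power_mult_distrib algebra_simps)
      finally have "Z x - Z x\<^sub>0 \<ge> r\<^sup>2 / N k * (q T / 2 - \<epsilon>' * (norm T)\<^sup>2)" .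
      then have "N k * (Z x - Z x\<^sub>0) \<ge> N k * (r\<^sup>2 / N k * (q T / 2 - \<epsilon>' * (norm T)\<^sup>2))"
        using Nk by (intro mult_left_mono) auto
      also have "N k * (r\<^sup>2 / N k * (q T / 2 - \<epsilon>' * (norm T)\<^sup>2)) = r\<^sup>2 * (q T / 2 - \<epsilon>' * (norm T)\<^sup>2)"
        using Nk by simp
      finally have ge: "N k * (Z x - Z x\<^sub>0) \<ge> r\<^sup>2 * (q T / 2 - \<epsilon>' * (norm T)\<^sup>2)" .
      have "\<epsilon>' * (norm T)\<^sup>2 \<le> \<epsilon>' * R'\<^sup>2"
        using T \<open>\<epsilon>' > 0\<close> by (intro mult_left_mono power_mono) auto
      also have "\<dots> = q K / 32" using \<open>R' > 0\<close> by (simp add: \<epsilon>'_def)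
      finally have "q T / 2 - \<epsilon>' * (norm T)\<^sup>2 \<ge> q K / 32" using qT by linarith
      then have "r\<^sup>2 * (q T / 2 - \<epsilon>' * (norm T)\<^sup>2) \<ge> r\<^sup>2 * (q K / 32)"
        by (intro mult_left_mono) auto
      moreover have "r\<^sup>2 * (q K / 32) \<ge> r * (q K / 32)"
        using \<open>r \<ge> 1\<close> qK by (intro mult_right_mono) (auto simp: power2_eq_square)
      moreover have "r * (q K / 32) > \<bar>C\<bar>"
        using sk'(3) qK by (simp add: field_simps)
      ultimately show "N k * (Z x - Z x\<^sub>0) > C" using ge by linarith
    qed
  qed
qed

end

section \<open>Limits of quadratic functionals of normalized sums\<close>

text \<open>A substitute for "\<open>Y\<close> converges in law to a symmetric limit", restricted to
  one test function and naming no limit variable.\<close>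

definition symmetric_limit ::
  "'w measure \<Rightarrow> (nat \<Rightarrow> 'w \<Rightarrow> 'b::real_normed_vector) \<Rightarrow>
    ('b \<Rightarrow> 'c::{banach, second_countable_topology}) \<Rightarrow> bool" where
  "symmetric_limit M Y f \<longleftrightarrow>
     (\<exists>l. (\<lambda>n. \<integral>\<omega>. f (Y n \<omega>) \<partial>M) \<longlonglongrightarrow> l \<and> (\<lambda>n. \<integral>\<omega>. f (- Y n \<omega>) \<partial>M) \<longlonglongrightarrow> l)"

lemma (in prob_space) integral_dist_le:
  fixes f g :: "'a \<Rightarrow> 'c::{banach, second_countable_topology}"
  assumes "integrable M f" "integrable M g" "\<And>x. norm (f x - g x) \<le> e"
  shows "norm ((\<integral>x. f x \<partial>M) - (\<integral>x. g x \<partial>M)) \<le> e"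
proof -
  have "norm ((\<integral>x. f x \<partial>M) - (\<integral>x. g x \<partial>M)) = norm (\<integral>x. f x - g x \<partial>M)"
    using assms by simp
  also have "\<dots> \<le> (\<integral>x. norm (f x - g x) \<partial>M)"
    by (rule integral_norm_bound)
  also have "\<dots> \<le> (\<integral>x. e \<partial>M)"
    using assms by (intro integral_mono) auto
  finally show ?thesis by (simp add: prob_space)
qed

context prob_space
begin

context
  fixes Y :: "nat \<Rightarrow> 'a \<Rightarrow> 'b::euclidean_space"
  assumes Y[measurable]: "\<And>n. Y n \<in> borel_measurable M"
begin

text \<open>Fubini moves the mixing integral outside, and dominated convergence with the uniform
  bound \<open>C\<close> passes to the limit for each \<open>s\<close> separately.\<close>

lemma symmetric_limit_mixture:
  fixes f :: "'s \<Rightarrow> 'b \<Rightarrow> 'c::{banach, second_countable_topology}"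
  assumes N: "prob_space N"
    and f[measurable]: "(\<lambda>(s, y). f s y) \<in> borel_measurable (N \<Otimes>\<^sub>M borel)"
    and bound: "\<And>s y. norm (f s y) \<le> C"
    and lim: "\<And>s. symmetric_limit M Y (f s)"
  shows "symmetric_limit M Y (\<lambda>y. \<integral>s. f s y \<partial>N)"
proof -
  interpret N: prob_space N by (rule N)
  interpret pair_sigma_finite N M by unfold_locales
  interpret NM: pair_prob_space N M by unfold_locales
  obtain l where l: "\<And>s. (\<lambda>n. \<integral>\<omega>. f s (Y n \<omega>) \<partial>M) \<longlonglongrightarrow> l s"
      "\<And>s. (\<lambda>n. \<integral>\<omega>. f s (- Y n \<omega>) \<partial>M) \<longlonglongrightarrow> l s"
    using lim unfolding symmetric_limit_def by metis
  have swap: "(\<integral>\<omega>. (\<integral>s. f s (U \<omega>) \<partial>N) \<partial>M) = (\<integral>s. (\<integral>\<omega>. f s (U \<omega>) \<partial>M) \<partial>N)"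
    if [measurable]: "U \<in> borel_measurable M" for U
  proof (rule Fubini_integral)
    show "integrable (N \<Otimes>\<^sub>M M) (\<lambda>(s, \<omega>). f s (U \<omega>))"
      using bound by (intro NM.P.integrable_const_bound[of _ C]) auto
  qed
  have conv: "(\<lambda>n. \<integral>\<omega>. (\<integral>s. f s (U n \<omega>) \<partial>N) \<partial>M) \<longlonglongrightarrow> (\<integral>s. l s \<partial>N)"
    if [measurable]: "\<And>n. U n \<in> borel_measurable M"
      and U: "\<And>s. (\<lambda>n. \<integral>\<omega>. f s (U n \<omega>) \<partial>M) \<longlonglongrightarrow> l s" for U
  proof -
    have meas[measurable]: "(\<lambda>s. \<integral>\<omega>. f s (U n \<omega>) \<partial>M) \<in> borel_measurable N" for n
      by measurable
    have [measurable]: "l \<in> borel_measurable N"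
      using meas U by (rule borel_measurable_LIMSEQ_metric)
    have "norm (\<integral>\<omega>. f s (U n \<omega>) \<partial>M) \<le> C" for s n
    proof -
      have "norm (\<integral>\<omega>. f s (U n \<omega>) \<partial>M) \<le> (\<integral>\<omega>. norm (f s (U n \<omega>)) \<partial>M)"
        by (rule integral_norm_bound)
      also have "\<dots> \<le> (\<integral>\<omega>. C \<partial>M)"
      proof (rule integral_mono')
        show "0 \<le> C" using bound[of s 0] norm_ge_zero order_trans by blast
      qed (use bound in auto)
      finally show ?thesis by (simp add: prob_space)
    qed
    then have "(\<lambda>n. \<integral>s. (\<integral>\<omega>. f s (U n \<omega>) \<partial>M) \<partial>N) \<longlonglongrightarrow> (\<integral>s. l s \<partial>N)"
      using U by (intro integral_dominated_convergence[where w = "\<lambda>_. C"]) auto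
    then show ?thesis by (simp add: swap)
  qed
  show ?thesis
    unfolding symmetric_limit_def
    using conv[of Y] conv[of "\<lambda>n \<omega>. - Y n \<omega>"] l by auto
qed

lemma symmetric_limit_uniform_approx:
  fixes f :: "'b \<Rightarrow> 'c::{banach, second_countable_topology}"
  assumes f[measurable]: "f \<in> borel_measurable borel" and bound: "\<And>y. norm (f y) \<le> C"
    and approx: "\<And>e. e > 0 \<Longrightarrow> \<exists>g. g \<in> borel_measurable borel \<and> symmetric_limit M Y g \<and>
      (\<forall>y. norm (f y - g y) \<le> e)"
  shows "symmetric_limit M Y f"
proof -
  define a where "a n = (\<integral>\<omega>. f (Y n \<omega>) \<partial>M)" for n
  define b where "b n = (\<integral>\<omega>. f (- Y n \<omega>) \<partial>M)" for n
  \<comment> \<open>The limit obtained for the approximant \<open>g\<close> varies with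
    \<open>e\<close>, so convergence for \<open>f\<close> has to come from the Cauchy criterion.
    Approximation and convergence each cost \<open>e / 4\<close>.\<close>
  have near: "\<exists>n\<^sub>0. \<forall>m\<ge>n\<^sub>0. \<forall>n\<ge>n\<^sub>0. dist (a m) (a n) < e \<and> norm (a n - b n) < e" if "e > 0" for e
  proof -
    from approx[of "e / 4"] \<open>e > 0\<close> obtain g where
      [measurable]: "g \<in> borel_measurable borel" and "symmetric_limit M Y g"
      and g: "\<And>y. norm (f y - g y) \<le> e / 4"
      by auto
    have "norm (g y) \<le> C + e / 4" for y
      using norm_triangle_ineq4[of "f y" "f y - g y"] bound[of y] g[of y] by simp
    then have int: "integrable M (\<lambda>\<omega>. f (U \<omega>))" "integrable M (\<lambda>\<omega>. g (U \<omega>))"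
      if [measurable]: "U \<in> borel_measurable M" for U :: "'a \<Rightarrow> 'b"
      using bound by (auto intro: integrable_const_bound[of _ C] integrable_const_bound[of _ "C + e / 4"])
    have close: "norm ((\<integral>\<omega>. f (U \<omega>) \<partial>M) - (\<integral>\<omega>. g (U \<omega>) \<partial>M)) \<le> e / 4"
      if "U \<in> borel_measurable M" for U
      using int[OF that] g by (intro integral_dist_le) auto
    from \<open>symmetric_limit M Y g\<close> obtain l where
      l: "(\<lambda>n. \<integral>\<omega>. g (Y n \<omega>) \<partial>M) \<longlonglongrightarrow> l" "(\<lambda>n. \<integral>\<omega>. g (- Y n \<omega>) \<partial>M) \<longlonglongrightarrow> l"
      unfolding symmetric_limit_def by blast
    obtain n1 where n1: "\<And>n. n \<ge> n1 \<Longrightarrow> norm ((\<integral>\<omega>. g (Y n \<omega>) \<partial>M) - l) < e / 4"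
      using LIMSEQ_D[OF l(1), of "e / 4"] \<open>e > 0\<close> by auto
    obtain n2 where n2: "\<And>n. n \<ge> n2 \<Longrightarrow> norm ((\<integral>\<omega>. g (- Y n \<omega>) \<partial>M) - l) < e / 4"
      using LIMSEQ_D[OF l(2), of "e / 4"] \<open>e > 0\<close> by auto
    have an: "norm (a n - l) < e / 2" if "n \<ge> n1" for n
      using norm_triangle_ineq[of "a n - (\<integral>\<omega>. g (Y n \<omega>) \<partial>M)" "(\<integral>\<omega>. g (Y n \<omega>) \<partial>M) - l"]
        close[of "Y n"] n1[OF that] by (simp add: a_def)
    have bn: "norm (b n - l) < e / 2" if "n \<ge> n2" for n
      using norm_triangle_ineq[of "b n - (\<integral>\<omega>. g (- Y n \<omega>) \<partial>M)" "(\<integral>\<omega>. g (- Y n \<omega>) \<partial>M) - l"]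
        close[of "\<lambda>\<omega>. - Y n \<omega>"] n2[OF that] by (simp add: b_def)
    show ?thesis
    proof (intro exI[of _ "max n1 n2"] allI impI conjI)
      fix m n assume mn: "max n1 n2 \<le> m" "max n1 n2 \<le> n"
      show "dist (a m) (a n) < e"
        using norm_triangle_ineq4[of "a m - l" "a n - l"] an[of m] an[of n] mn
        by (simp add: dist_norm)
      show "norm (a n - b n) < e"
        using norm_triangle_ineq4[of "a n - l" "b n - l"] an[of n] bn[of n] mn by simp
    qed
  qed
  have "Cauchy a"
    using near unfolding Cauchy_def by meson
  then obtain l where l: "a \<longlonglongrightarrow> l" using Cauchy_convergent convergent_def by blast
  have "(\<lambda>n. a n - b n) \<longlonglongrightarrow> 0"
    using near unfolding LIMSEQ_iff by (metis diff_zero)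
  from tendsto_diff[OF l this] have "b \<longlonglongrightarrow> l" by simp
  with l show ?thesis unfolding symmetric_limit_def a_def b_def by blast
qed

context
  assumes char_limit: "\<And>t. symmetric_limit M Y (\<lambda>y. iexp (t \<bullet> y))"
begin

text \<open>Each factor \<open>exp (- x\<^sup>2 / 2)\<close> is the characteristic function of the standard normal
  distribution at \<open>x\<close>, so it is a mixture of characters.\<close>

lemma symmetric_limit_gaussian:
  "symmetric_limit M Y
     (\<lambda>y. iexp (t \<bullet> y) * complex_of_real (exp (- (\<Sum>(a, b)\<leftarrow>ps. (a \<bullet> y + b)\<^sup>2) / 2)))"
\<comment> \<open>The frequency stays arbitrary because mixing over \<open>s\<close> shifts
  \<open>t\<close> to \<open>t + s a\<close>.\<close>
proof (induction ps arbitrary: t)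
  case Nil
  then show ?case using char_limit by simp
next
  case (Cons p ps)
  obtain a b where p: "p = (a, b)" by (cases p)
  let ?N = "std_normal_distribution"
  interpret N: real_distribution ?N by (rule real_dist_normal_dist)
  define G where "G y = exp (- (\<Sum>(a, b)\<leftarrow>ps. (a \<bullet> y + b)\<^sup>2) / 2)" for y :: 'b
  have "continuous_on UNIV (\<lambda>y. \<Sum>(a, b)\<leftarrow>ps. (a \<bullet> y + b)\<^sup>2)"
    by (induction ps) (auto intro!: continuous_intros)
  then have G[measurable]: "G \<in> borel_measurable borel"
    unfolding G_def by (intro borel_measurable_continuous_onI continuous_intros) auto
  have G_le: "0 \<le> G y" "G y \<le> 1" for y
    by (auto simp: G_def intro!: sum_list_nonneg)
  \<comment> \<open>The offset \<open>b\<close> contributes a phase free of \<open>y\<close>, which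
    leaves the expectation as a constant factor.\<close>
  define f where "f s y = iexp (b * s) * (iexp ((t + s *\<^sub>R a) \<bullet> y) * complex_of_real (G y))"
    for s y
  have "symmetric_limit M Y (\<lambda>y. \<integral>s. f s y \<partial>?N)"
  proof (rule symmetric_limit_mixture)
    show "prob_space ?N" by unfold_locales
    show "(\<lambda>(s, y). f s y) \<in> borel_measurable (?N \<Otimes>\<^sub>M borel)"
      unfolding f_def by measurable
    show "norm (f s y) \<le> 1" for s y
      using G_le by (simp add: f_def norm_mult)
    show "symmetric_limit M Y (f s)" for s
    proof -
      obtain l where
        l: "(\<lambda>n. \<integral>\<omega>. iexp ((t + s *\<^sub>R a) \<bullet> Y n \<omega>) * complex_of_real (G (Y n \<omega>)) \<partial>M) \<longlonglongrightarrow> l"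
          "(\<lambda>n. \<integral>\<omega>. iexp ((t + s *\<^sub>R a) \<bullet> - Y n \<omega>) * complex_of_real (G (- Y n \<omega>)) \<partial>M) \<longlonglongrightarrow> l"
        using Cons.IH[of "t + s *\<^sub>R a"] unfolding symmetric_limit_def G_def by blast
      show ?thesis
        unfolding symmetric_limit_def f_def integral_mult_right_zero
        using tendsto_mult_left[OF l(1), of "iexp (b * s)"]
          tendsto_mult_left[OF l(2), of "iexp (b * s)"] by blast
    qed
  qed
  moreover have "(\<integral>s. f s y \<partial>?N) = iexp (t \<bullet> y) *
      complex_of_real (exp (- (\<Sum>(a, b)\<leftarrow>p # ps. (a \<bullet> y + b)\<^sup>2) / 2))" for y
  proof -
    have "f s y = iexp (t \<bullet> y) * complex_of_real (G y) * iexp ((a \<bullet> y + b) * s)" for s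
      by (simp add: f_def inner_add_left algebra_simps exp_add)
    then have "(\<integral>s. f s y \<partial>?N) = iexp (t \<bullet> y) * complex_of_real (G y) * char ?N (a \<bullet> y + b)"
      by (simp add: char_def)
    also have "\<dots> = iexp (t \<bullet> y) * complex_of_real (G y * exp (- ((a \<bullet> y + b)\<^sup>2) / 2))"
      by (simp add: char_std_normal_distribution)
    also have "G y * exp (- ((a \<bullet> y + b)\<^sup>2) / 2) = exp (- (\<Sum>(a, b)\<leftarrow>p # ps. (a \<bullet> y + b)\<^sup>2) / 2)"
      by (simp add: G_def p exp_add[symmetric] add_divide_distrib diff_divide_distrib)
    finally show ?thesis .
  qed
  ultimately show ?case by simp
qed

text \<open>As \<open>q\<close> is nonnegative, \<open>E = exp (- q / 2)\<close> lies in the unit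
  interval, and \<open>g\<close> of \<open>q / 2\<close> is a function \<open>h\<close> of
  \<open>E\<close>. The constant tail of \<open>g\<close> makes \<open>h\<close> continuous up to 0,
  the value that corresponds to \<open>q\<close> tending to infinity, so polynomials in
  \<open>E\<close> approximate uniformly.\<close>

lemma symmetric_limit_sum_of_squares:
  fixes g :: "real \<Rightarrow> real"
  assumes q: "\<And>v. q v = (\<Sum>a\<leftarrow>as. (a \<bullet> v)\<^sup>2)"
    and g: "continuous_on {0..} g" and const: "\<And>x. B \<le> x \<Longrightarrow> g x = g B" and "0 \<le> B"
  shows "symmetric_limit M Y (\<lambda>y. g (q (y + v) / 2))"
proof -
  have "continuous_on UNIV (\<lambda>v. \<Sum>a\<leftarrow>as. (a \<bullet> v)\<^sup>2)"
    by (induction as) (auto intro!: continuous_intros)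
  then have q_cont: "continuous_on UNIV q" using q by presburger
  then have [measurable]: "q \<in> borel_measurable borel" by (rule borel_measurable_continuous_onI)
  have q_nonneg: "0 \<le> q w" for w unfolding q by (rule sum_list_nonneg) auto
  define E where "E y = exp (- (q (y + v) / 2))" for y
  have E[measurable]: "E \<in> borel_measurable borel" unfolding E_def by measurable
  have E01: "0 < E y" "E y \<le> 1" for y using q_nonneg by (auto simp: E_def)
  have E_power: "symmetric_limit M Y (\<lambda>y. E y ^ k)" for k :: nat
  proof -
    \<comment> \<open>Scaling the linear forms by \<open>sqrt k\<close> multiplies the quadratic
      form by \<open>k\<close>, so a power of \<open>E\<close> is again a Gaussian; the shift
      \<open>v\<close> becomes the offsets.\<close>
    define ps where "ps = map (\<lambda>a. (sqrt k *\<^sub>R a, sqrt k * (a \<bullet> v))) as"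
    have "(\<Sum>(a, b)\<leftarrow>ps. (a \<bullet> y + b)\<^sup>2) = k * q (y + v)" for y
      unfolding q ps_def
      by (induction as) (auto simp: inner_add_right power_mult_distrib distrib_left[symmetric])
    then have E_eq: "exp (- (\<Sum>(a, b)\<leftarrow>ps. (a \<bullet> y + b)\<^sup>2) / 2) = E y ^ k" for y
      by (simp add: E_def exp_of_nat_mult[symmetric])
    have "symmetric_limit M Y (\<lambda>y. complex_of_real (E y ^ k))"
      using symmetric_limit_gaussian[of 0 ps] unfolding E_eq by simp
    then obtain l where "(\<lambda>n. complex_of_real (\<integral>\<omega>. E (Y n \<omega>) ^ k \<partial>M)) \<longlonglongrightarrow> l"
        "(\<lambda>n. complex_of_real (\<integral>\<omega>. E (- Y n \<omega>) ^ k \<partial>M)) \<longlonglongrightarrow> l"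
      unfolding symmetric_limit_def integral_complex_of_real by blast
    from this[THEN tendsto_Re] show ?thesis
      unfolding symmetric_limit_def by auto
  qed
  \<comment> \<open>The maximum truncates \<open>- ln x\<close> at \<open>B\<close>, avoiding the
    singularity at 0; beyond \<open>B\<close> the function \<open>g\<close> does not see the
    truncation.\<close>
  define h where "h x = g (- ln (max x (exp (- B))))" for x
  have h_cont: "continuous_on {0..1} h"
    unfolding h_def
  proof (rule continuous_on_compose2[OF g])
    show "continuous_on {0..1} (\<lambda>x. - ln (max x (exp (- B))))"
      by (intro continuous_intros) (auto simp: max_def)
    show "(\<lambda>x. - ln (max x (exp (- B)))) ` {0..1} \<subseteq> {0..}"
    proof (intro image_subsetI)
      fix x :: real assume "x \<in> {0..1}"
      then have "0 < max x (exp (- B))" "max x (exp (- B)) \<le> 1"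
        using \<open>0 \<le> B\<close> by (simp_all add: less_max_iff_disj)
      then show "- ln (max x (exp (- B))) \<in> {0..}" by simp
    qed
  qed
  have hE: "g (q (y + v) / 2) = h (E y)" for y
  proof -
    have "- ln (max (E y) (exp (- B))) = min (q (y + v) / 2) B"
      by (auto simp: E_def max_def min_def)
    then show ?thesis using const[of "q (y + v) / 2"] by (auto simp: h_def min_def)
  qed
  have "compact (h ` {0..1})"
    using h_cont by (rule compact_continuous_image) simp
  then obtain C where C: "\<And>x. x \<in> {0..1} \<Longrightarrow> norm (h x) \<le> C"
    using compact_imp_bounded bounded_iff by (metis imageI)
  have [measurable]: "(\<lambda>y. h (E y)) \<in> borel_measurable borel"
  proof (rule borel_measurable_continuous_onI, rule continuous_on_compose2[OF h_cont])
    show "continuous_on UNIV E"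
      unfolding E_def
      by (intro continuous_intros continuous_on_compose2[OF q_cont]) auto
    show "range E \<subseteq> {0..1}" using E01 by (auto simp: less_imp_le)
  qed
  have "symmetric_limit M Y (\<lambda>y. h (E y))"
  proof (rule symmetric_limit_uniform_approx)
    show "(\<lambda>y. h (E y)) \<in> borel_measurable borel" by measurable
    show "norm (h (E y)) \<le> C" for y using C[of "E y"] E01[of y] by simp
    fix e :: real assume "e > 0"
    obtain p where "real_polynomial_function p" and p: "\<And>x. x \<in> {0..1} \<Longrightarrow> \<bar>h x - p x\<bar> < e"
      using Stone_Weierstrass_real_polynomial_function[of "{0..1}" h e] h_cont \<open>e > 0\<close> by auto
    then obtain c m where pc: "p = (\<lambda>x. \<Sum>i\<le>m. c i * x ^ i)"
      unfolding real_polynomial_function_iff_sum by blast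
    have [measurable]: "p \<in> borel_measurable borel" unfolding pc by measurable
    obtain l where
      l: "\<And>i. (\<lambda>n. \<integral>\<omega>. E (Y n \<omega>) ^ i \<partial>M) \<longlonglongrightarrow> l i" "\<And>i. (\<lambda>n. \<integral>\<omega>. E (- Y n \<omega>) ^ i \<partial>M) \<longlonglongrightarrow> l i"
      using E_power unfolding symmetric_limit_def by metis
    have int: "integrable M (\<lambda>\<omega>. c i * E (U \<omega>) ^ i)" if [measurable]: "U \<in> borel_measurable M" for i U
      using E01 by (intro integrable_mult_right integrable_const_bound[of _ 1])
        (auto simp: power_le_one less_imp_le)
    have sum_eq: "(\<integral>\<omega>. p (E (U \<omega>)) \<partial>M) = (\<Sum>i\<le>m. c i * (\<integral>\<omega>. E (U \<omega>) ^ i \<partial>M))"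
      if "U \<in> borel_measurable M" for U
      using int[OF that] by (simp add: pc Bochner_Integration.integral_sum)
    have "symmetric_limit M Y (\<lambda>y. p (E y))"
      unfolding symmetric_limit_def using sum_eq[of "Y _"] sum_eq[of "\<lambda>\<omega>. - Y _ \<omega>"]
      by (intro exI[of _ "\<Sum>i\<le>m. c i * l i"]) (auto intro!: tendsto_intros l)
    then show "\<exists>g. g \<in> borel_measurable borel \<and> symmetric_limit M Y g \<and> (\<forall>y. norm (h (E y) - g y) \<le> e)"
      using p E01 by (intro exI[of _ "\<lambda>y. p (E y)"]) (auto simp: less_imp_le)
  qed
  then show ?thesis by (simp add: hE)
qed

end

end

end

section \<open>Normalized sums of centered i.i.d. vectors\<close>

lemma (in prob_space) indep_vars_second_moment_sum:
  fixes X :: "nat \<Rightarrow> 'a \<Rightarrow> real"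
  assumes indep: "indep_vars (\<lambda>_. borel) X UNIV"
    and mean: "\<And>i. expectation (X i) = 0"
    and sq: "\<And>i. integrable M (\<lambda>\<omega>. (X i \<omega>)\<^sup>2)"
  shows "integrable M (\<lambda>\<omega>. (\<Sum>i<n. X i \<omega>)\<^sup>2)"
    "expectation (\<lambda>\<omega>. (\<Sum>i<n. X i \<omega>)\<^sup>2) = (\<Sum>i<n. expectation (\<lambda>\<omega>. (X i \<omega>)\<^sup>2))"
proof (induction n)
  case (Suc n)
  have rv[measurable]: "X i \<in> borel_measurable M" for i
    using indep unfolding indep_vars_def by auto
  have int: "integrable M (X i)" for i
    by (rule square_integrable_imp_integrable[OF rv sq])
  have "indep_vars (\<lambda>_. borel) X (insert n {..<n})"
    by (rule indep_vars_subset[OF indep]) simp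
  then have indep_sum: "indep_var borel (X n) borel (\<lambda>\<omega>. \<Sum>i<n. X i \<omega>)"
    by (rule indep_vars_sum[rotated 2]) simp_all
  have int_sum: "integrable M (\<lambda>\<omega>. \<Sum>i<n. X i \<omega>)"
    by (rule Bochner_Integration.integrable_sum) (rule int)
  \<comment> \<open>\<open>X n\<close> is independent of the preceding partial sum, so the mixed
    expectation factors and vanishes with the mean of \<open>X n\<close>.\<close>
  have cross: "integrable M (\<lambda>\<omega>. X n \<omega> * (\<Sum>i<n. X i \<omega>))"
      "expectation (\<lambda>\<omega>. X n \<omega> * (\<Sum>i<n. X i \<omega>)) = 0"
    using indep_var_integrable[OF indep_sum int int_sum]
      indep_var_lebesgue_integral[OF indep_sum int int_sum] mean by simp_all
  have eq: "(\<Sum>i<Suc n. X i \<omega>)\<^sup>2 = (\<Sum>i<n. X i \<omega>)\<^sup>2 + 2 * (X n \<omega> * (\<Sum>i<n. X i \<omega>)) + (X n \<omega>)\<^sup>2" for \<omega>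
    by (simp add: power2_eq_square algebra_simps)
  { case 1 show ?case unfolding eq using Suc.IH(1) cross(1) sq by simp }
  { case 2 show ?case unfolding eq using Suc.IH cross sq by simp }
qed (auto simp: prob_space)

text \<open>\<open>X i\<close> will be the influence function at an observation minus its mean.
  Moments are stated for real projections because the central limit theorem is applied to one
  projection at a time.\<close>

locale centered_iid = prob_space M for M :: "'w measure" +
  fixes X :: "nat \<Rightarrow> 'w \<Rightarrow> 'b::euclidean_space"
  assumes indep: "indep_vars (\<lambda>_. borel) X UNIV"
    and ident: "\<And>i. distr M borel (X i) = distr M borel (X 0)"
    and centered: "\<And>t. expectation (\<lambda>\<omega>. t \<bullet> X 0 \<omega>) = 0"
    and square_integrable: "\<And>t. integrable M (\<lambda>\<omega>. (t \<bullet> X 0 \<omega>)\<^sup>2)"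
begin

definition normalized_sum :: "nat \<Rightarrow> 'w \<Rightarrow> 'b" where
  "normalized_sum n \<omega> = (1 / sqrt (real n)) *\<^sub>R (\<Sum>i<n. X i \<omega>)"

lemma measurable_X[measurable]: "X i \<in> borel_measurable M"
  using indep unfolding indep_vars_def by auto

lemma measurable_normalized_sum[measurable]: "normalized_sum n \<in> borel_measurable M"
  unfolding normalized_sum_def by measurable

lemma inner_normalized_sum:
  "t \<bullet> normalized_sum n \<omega> = (\<Sum>i<n. t \<bullet> X i \<omega>) / sqrt (real n)"
  by (simp add: normalized_sum_def inner_sum_right)

lemma indep_inner: "indep_vars (\<lambda>_. borel) (\<lambda>i \<omega>. t \<bullet> X i \<omega>) UNIV"
  by (rule indep_vars_compose2[OF indep]) simp

lemma
  fixes f :: "'b \<Rightarrow> real"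
  assumes f[measurable]: "f \<in> borel_measurable borel"
  shows expectation_ident: "expectation (\<lambda>\<omega>. f (X i \<omega>)) = expectation (\<lambda>\<omega>. f (X 0 \<omega>))"
    and integrable_ident: "integrable M (\<lambda>\<omega>. f (X i \<omega>)) \<longleftrightarrow> integrable M (\<lambda>\<omega>. f (X 0 \<omega>))"
  using integral_distr[of "X i" M borel f] integral_distr[of "X 0" M borel f]
    integrable_distr_eq[of "X i" M borel f] integrable_distr_eq[of "X 0" M borel f] ident[of i]
  by auto

lemma second_moment_normalized_sum:
  assumes "n \<ge> 1"
  shows "integrable M (\<lambda>\<omega>. (t \<bullet> normalized_sum n \<omega>)\<^sup>2)"
    "expectation (\<lambda>\<omega>. (t \<bullet> normalized_sum n \<omega>)\<^sup>2) = expectation (\<lambda>\<omega>. (t \<bullet> X 0 \<omega>)\<^sup>2)"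
proof -
  have "expectation (\<lambda>\<omega>. t \<bullet> X i \<omega>) = 0" "integrable M (\<lambda>\<omega>. (t \<bullet> X i \<omega>)\<^sup>2)" for i
    using expectation_ident[of "\<lambda>x. t \<bullet> x" i] integrable_ident[of "\<lambda>x. (t \<bullet> x)\<^sup>2" i]
      centered square_integrable by auto
  note sums = indep_vars_second_moment_sum[OF indep_inner this, of n]
  have eq: "(t \<bullet> normalized_sum n \<omega>)\<^sup>2 = (\<Sum>i<n. t \<bullet> X i \<omega>)\<^sup>2 / n" for \<omega>
    using assms by (simp add: inner_normalized_sum power_divide)
  show "integrable M (\<lambda>\<omega>. (t \<bullet> normalized_sum n \<omega>)\<^sup>2)"
    unfolding eq using sums(1) by simp
  show "expectation (\<lambda>\<omega>. (t \<bullet> normalized_sum n \<omega>)\<^sup>2) = expectation (\<lambda>\<omega>. (t \<bullet> X 0 \<omega>)\<^sup>2)"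
  proof -
    have "(\<Sum>i<n. expectation (\<lambda>\<omega>. (t \<bullet> X i \<omega>)\<^sup>2)) = (\<Sum>i<n. expectation (\<lambda>\<omega>. (t \<bullet> X 0 \<omega>)\<^sup>2))"
      by (intro sum.cong refl expectation_ident[of "\<lambda>x. (t \<bullet> x)\<^sup>2"]) simp
    then show ?thesis unfolding eq using sums(2) assms by simp
  qed
qed

text \<open>Chebyshev: for every \<open>n \<ge> 1\<close> the second moment of the norm is the trace
  of the covariance, which serves as \<open>V\<close>.\<close>

lemma normalized_sum_tight:
  "\<exists>V. \<forall>n\<ge>1. \<forall>R>0. prob {\<omega> \<in> space M. norm (normalized_sum n \<omega>) > R} \<le> V / R\<^sup>2"
proof (rule exI, intro allI impI)
  fix n :: nat and R :: real
  assume "n \<ge> 1" "R > 0"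
  let ?Y = "normalized_sum n"
  have norm_eq: "(norm (?Y \<omega>))\<^sup>2 = (\<Sum>e\<in>Basis. (e \<bullet> ?Y \<omega>)\<^sup>2)" for \<omega>
    unfolding power2_norm_eq_inner
    by (subst euclidean_inner) (simp only: power2_eq_square inner_commute)
  have "prob {\<omega> \<in> space M. norm (?Y \<omega>) > R} \<le> prob {\<omega> \<in> space M. (norm (?Y \<omega>))\<^sup>2 \<ge> R\<^sup>2}"
  proof (rule finite_measure_mono)
    show "{\<omega> \<in> space M. norm (?Y \<omega>) > R} \<subseteq> {\<omega> \<in> space M. (norm (?Y \<omega>))\<^sup>2 \<ge> R\<^sup>2}"
      using \<open>R > 0\<close> by (auto intro: power_mono)
  qed measurable
  also have "\<dots> \<le> expectation (\<lambda>\<omega>. (norm (?Y \<omega>))\<^sup>2) / R\<^sup>2"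
  proof (rule integral_Markov_inequality_measure[where A = "{}"])
    show "integrable M (\<lambda>\<omega>. (norm (?Y \<omega>))\<^sup>2)"
      unfolding norm_eq using second_moment_normalized_sum(1)[OF \<open>n \<ge> 1\<close>] by simp
  qed (use \<open>R > 0\<close> in auto)
  also have "expectation (\<lambda>\<omega>. (norm (?Y \<omega>))\<^sup>2) = (\<Sum>e\<in>Basis. expectation (\<lambda>\<omega>. (e \<bullet> X 0 \<omega>)\<^sup>2))"
    unfolding norm_eq using second_moment_normalized_sum[OF \<open>n \<ge> 1\<close>]
    by (simp add: Bochner_Integration.integral_sum)
  finally show "prob {\<omega> \<in> space M. norm (?Y \<omega>) > R} \<le>
      (\<Sum>e\<in>Basis. expectation (\<lambda>\<omega>. (e \<bullet> X 0 \<omega>)\<^sup>2)) / R\<^sup>2" .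
qed

lemma char_normalized_sum_tendsto:
  "(\<lambda>n. \<integral>\<omega>. iexp (t \<bullet> normalized_sum n \<omega>) \<partial>M)
    \<longlonglongrightarrow> complex_of_real (exp (- expectation (\<lambda>\<omega>. (t \<bullet> X 0 \<omega>)\<^sup>2) / 2))"
proof -
  define v where "v = expectation (\<lambda>\<omega>. (t \<bullet> X 0 \<omega>)\<^sup>2)"
  have "v \<ge> 0" by (simp add: v_def)
  show ?thesis
  proof (cases "v = 0")
    \<comment> \<open>A direction of zero variance lies outside the central limit theorem, but there
      the projection vanishes almost surely.\<close>
    case True
    have "(\<integral>\<omega>. iexp (t \<bullet> normalized_sum n \<omega>) \<partial>M) = 1" if "n \<ge> 1" for n
    proof -
      have "AE \<omega> in M. (t \<bullet> normalized_sum n \<omega>)\<^sup>2 = 0"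
        using second_moment_normalized_sum[OF that, of t] True
        by (subst integral_nonneg_eq_0_iff_AE[symmetric]) (auto simp: v_def)
      then have "(\<integral>\<omega>. iexp (t \<bullet> normalized_sum n \<omega>) \<partial>M) = (\<integral>\<omega>. 1 \<partial>M)"
        by (intro integral_cong_AE) auto
      then show ?thesis by (simp add: prob_space)
    qed
    then have "\<forall>\<^sub>F n in sequentially. (\<integral>\<omega>. iexp (t \<bullet> normalized_sum n \<omega>) \<partial>M) = 1"
      by (auto simp: eventually_sequentially)
    then show ?thesis using True by (simp add: v_def tendsto_eventually)
  next
    case False
    then have "sqrt v > 0" using \<open>v \<ge> 0\<close> by simp
    have inner: "expectation (\<lambda>\<omega>. t \<bullet> X i \<omega>) = 0" "integrable M (\<lambda>\<omega>. (t \<bullet> X i \<omega>)\<^sup>2)"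
      "expectation (\<lambda>\<omega>. (t \<bullet> X i \<omega>)\<^sup>2) = v" for i
      using expectation_ident[of "\<lambda>x. t \<bullet> x" i] integrable_ident[of "\<lambda>x. (t \<bullet> x)\<^sup>2" i]
        expectation_ident[of "\<lambda>x. (t \<bullet> x)\<^sup>2" i] centered square_integrable by (auto simp: v_def)
    have "distr M borel (\<lambda>\<omega>. t \<bullet> X i \<omega>) = distr M borel (\<lambda>\<omega>. t \<bullet> X 0 \<omega>)" for i
      using arg_cong[OF ident[of i], of "\<lambda>N. distr N borel (\<lambda>x. t \<bullet> x)"]
      by (simp add: distr_distr comp_def)
    then have "weak_conv_m (\<lambda>n. distr M borel (\<lambda>\<omega>. (\<Sum>i<n. t \<bullet> X i \<omega>) / sqrt (n * (sqrt v)\<^sup>2)))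
        std_normal_distribution"
      using inner \<open>sqrt v > 0\<close> \<open>v \<ge> 0\<close>
      by (intro central_limit_theorem_zero_mean[OF indep_inner]) auto
    moreover have "(\<Sum>i<n. t \<bullet> X i \<omega>) / sqrt (n * (sqrt v)\<^sup>2) = t \<bullet> normalized_sum n \<omega> / sqrt v" for n \<omega>
      using \<open>v \<ge> 0\<close> by (simp add: inner_normalized_sum real_sqrt_mult)
    ultimately have "weak_conv_m (\<lambda>n. distr M borel (\<lambda>\<omega>. t \<bullet> normalized_sum n \<omega> / sqrt v))
        std_normal_distribution" by simp
    \<comment> \<open>Evaluating at \<open>sqrt v\<close> undoes the normalization by
      \<open>sqrt v\<close>.\<close>
    then have "(\<lambda>n. char (distr M borel (\<lambda>\<omega>. t \<bullet> normalized_sum n \<omega> / sqrt v)) (sqrt v))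
        \<longlonglongrightarrow> char std_normal_distribution (sqrt v)"
      by (intro levy_continuity1 real_dist_normal_dist real_distribution_distr) auto
    then show ?thesis
      using \<open>sqrt v > 0\<close> \<open>v \<ge> 0\<close>
      by (simp add: char_def integral_distr char_std_normal_distribution v_def)
  qed
qed

text \<open>Reflecting the sum replaces \<open>t\<close> by \<open>- t\<close>, and the limit
  depends on \<open>t\<close> only through a second moment, hence is even.\<close>

lemma symmetric_limit_char_normalized_sum:
  "symmetric_limit M normalized_sum (\<lambda>y. iexp (t \<bullet> y))"
  unfolding symmetric_limit_def
  using char_normalized_sum_tendsto[of t] char_normalized_sum_tendsto[of "- t"]
  by (intro exI conjI) auto

end

section \<open>Stochastic dominance of limit laws\<close>

text \<open>Subtracting a lower bound leaves one nonnegative integral, so extended expectations with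
  a common bound are compared without infinite differences.\<close>

lemma (in prob_space) ext_expectation_bounded_below:
  fixes f :: "'a \<Rightarrow> real"
  assumes f[measurable]: "f \<in> borel_measurable M" and ge: "AE x in M. c \<le> f x"
  shows "has_expectation M f"
    "ext_expectation M f = ereal c + enn2ereal (\<integral>\<^sup>+ x. ennreal (f x - c) \<partial>M)"
proof -
  define p where "p = (\<integral>\<^sup>+ x. ennreal (f x) \<partial>M)"
  define m where "m = (\<integral>\<^sup>+ x. ennreal (- f x) \<partial>M)"
  define w where "w = (\<integral>\<^sup>+ x. ennreal (f x - c) \<partial>M)"
  have "m \<le> (\<integral>\<^sup>+ x. ennreal (- c) \<partial>M)"
    unfolding m_def
  proof (rule nn_integral_mono_AE, use ge in eventually_elim)
    fix x assume "c \<le> f x"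
    then show "ennreal (- f x) \<le> ennreal (- c)" by (intro ennreal_leI) simp
  qed
  also have "\<dots> = ennreal (- c)" by (simp add: emeasure_space_1)
  finally have "m \<noteq> \<infinity>" using order.strict_trans1[OF _ ennreal_less_top] by fastforce
  then show "has_expectation M f" by (simp add: has_expectation_def m_def)
  \<comment> \<open>Every term is placed on the side where it is added, since subtraction in
    \<open>ennreal\<close> truncates; \<open>ennreal c\<close> and \<open>ennreal (- c)\<close>
    together cover both signs of \<open>c\<close>.\<close>
  have eq: "w + m + ennreal c = p + ennreal (- c)"
  proof -
    have "w + m + ennreal c = (\<integral>\<^sup>+ x. ennreal (f x - c) + ennreal (- f x) + ennreal c \<partial>M)"
      by (simp add: w_def m_def nn_integral_add emeasure_space_1)
    also have "\<dots> = (\<integral>\<^sup>+ x. ennreal (f x) + ennreal (- c) \<partial>M)"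
    proof (rule nn_integral_cong_AE, use ge in eventually_elim)
      fix x assume "c \<le> f x"
      then show "ennreal (f x - c) + ennreal (- f x) + ennreal c = ennreal (f x) + ennreal (- c)"
        by (cases "f x \<ge> 0"; cases "c \<ge> 0") (auto simp: ennreal_plus[symmetric] ennreal_neg simp del: ennreal_plus)
    qed
    also have "\<dots> = p + ennreal (- c)"
      by (simp add: p_def nn_integral_add emeasure_space_1)
    finally show ?thesis .
  qed
  have "enn2ereal p - enn2ereal m = ereal c + enn2ereal w"
    using eq \<open>m \<noteq> \<infinity>\<close>
    by (cases p; cases m; cases w; cases "c \<ge> 0")
      (auto simp: ennreal_plus[symmetric] ennreal_neg enn2ereal_ennreal top_ennreal.rep_eq
        simp del: ennreal_plus)
  then show "ext_expectation M f = ereal c + enn2ereal (\<integral>\<^sup>+ x. ennreal (f x - c) \<partial>M)"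
    by (simp add: ext_expectation_def p_def m_def w_def)
qed

text \<open>A bounded test function made from \<open>u\<close>. Freezing it at negative arguments
  does not affect integrals against the limit laws, which live on the nonnegative half-line,
  although the gap itself may be negative at finite \<open>n\<close>. Subtracting \<open>u 0\<close>
  makes it nonnegative for monotone \<open>u\<close> and \<open>m \<ge> 0\<close>.\<close>

definition capped :: "(real \<Rightarrow> real) \<Rightarrow> real \<Rightarrow> real \<Rightarrow> real" where
  "capped u m x = min (u (max x 0) - u 0) m"

lemma convex_real_continuous:
  fixes u :: "real \<Rightarrow> real"
  assumes "convex_on UNIV u"
  shows "continuous_on A u"
  using convex_on_continuous[OF open_UNIV assms] continuous_on_subset by blast

lemma capped_nonneg: "mono u \<Longrightarrow> 0 \<le> m \<Longrightarrow> 0 \<le> capped u m x"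
  using monoD[of u 0 "max x 0"] by (simp add: capped_def)

lemma capped_le: "capped u m x \<le> m"
  by (simp add: capped_def)

lemma continuous_on_capped:
  assumes "convex_on UNIV u"
  shows "continuous_on A (capped u m)"
  unfolding capped_def
  by (intro continuous_intros continuous_on_compose2[OF convex_real_continuous[OF assms, of UNIV]]) auto

text \<open>Either \<open>u - u 0\<close> reaches \<open>m\<close>, and monotonicity keeps it above,
  or \<open>u\<close> is constant on the nonnegative half-line, because a convex function that has
  once increased grows at least linearly.\<close>

lemma capped_eventually_constant:
  assumes mono: "mono u" and conv: "convex_on UNIV u"
  shows "\<exists>B\<ge>0. \<forall>x\<ge>B. capped u m x = capped u m B"
proof (cases "\<exists>x\<ge>0. u x - u 0 \<ge> m")
  case True
  then obtain B where B: "B \<ge> 0" "u B - u 0 \<ge> m" by blast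
  have "capped u m x = m" if "x \<ge> B" for x
    using B that monoD[OF mono, of B x] by (simp add: capped_def max_absorb1)
  then show ?thesis using B(1) by (intro exI[of _ B]) auto
next
  case False
  have const: "u x = u 0" if "x \<ge> 0" for x
  proof (rule ccontr)
    assume "u x \<noteq> u 0"
    then have pos: "u x - u 0 > 0" using monoD[OF mono \<open>x \<ge> 0\<close>] by simp
    \<comment> \<open>Convexity between 0 and \<open>t * x\<close> gives
      \<open>u (t * x) - u 0 \<ge> t * (u x - u 0)\<close>, and this \<open>t\<close> pushes the
      right side up to \<open>m\<close>.\<close>
    define t where "t = max 1 (m / (u x - u 0))"
    have "t \<ge> 1" "t * (u x - u 0) \<ge> m"
      using pos by (auto simp: t_def field_simps max_def)
    have "u ((1 - 1 / t) *\<^sub>R 0 + (1 / t) *\<^sub>R (t * x)) \<le> (1 - 1 / t) * u 0 + (1 / t) * u (t * x)"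
      using \<open>t \<ge> 1\<close> by (intro convex_onD[OF conv]) auto
    then have "t * u x \<le> t * ((1 - 1 / t) * u 0 + (1 / t) * u (t * x))"
      using \<open>t \<ge> 1\<close> by (intro mult_left_mono) auto
    also have "\<dots> = (t - 1) * u 0 + u (t * x)"
      using \<open>t \<ge> 1\<close> by (simp add: field_simps)
    finally have "t * (u x - u 0) \<le> u (t * x) - u 0" by (simp add: algebra_simps)
    with \<open>t * (u x - u 0) \<ge> m\<close> have "m \<le> u (t * x) - u 0" by linarith
    moreover have "0 \<le> t * x" using \<open>t \<ge> 1\<close> \<open>x \<ge> 0\<close> by simp
    ultimately show False using False by blast
  qed
  have "capped u m x = capped u m 0" for x
    using const[of "max x 0"] by (simp add: capped_def)
  then show ?thesis by blast
qed

text \<open>Capping destroys convexity; doubling the cap on the right restores the midpoint inequality.\<close>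

lemma capped_midpoint:
  assumes mono: "mono u" and conv: "convex_on UNIV u" and "0 \<le> m"
    and "0 \<le> a" "0 \<le> b" "0 \<le> c" "2 * a \<le> b + c"
  shows "capped u m a \<le> (capped u (2 * m) b + capped u (2 * m) c) / 2"
proof -
  have "u a \<le> u ((1 - 1 / 2) *\<^sub>R b + (1 / 2) *\<^sub>R c)"
    using assms by (intro monoD[OF mono]) simp
  also have "\<dots> \<le> (1 - 1 / 2) * u b + (1 / 2) * u c"
    by (intro convex_onD[OF conv]) auto
  finally have "u a - u 0 \<le> ((u b - u 0) + (u c - u 0)) / 2" by (simp add: field_simps)
  moreover have "u 0 \<le> u b" "u 0 \<le> u c" using assms by (auto intro: monoD[OF mono])
  \<comment> \<open>If one right-hand term reaches its cap \<open>2 * m\<close>, half of it already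
    equals the left cap; otherwise neither is cut and plain convexity applies.\<close>
  ultimately show ?thesis
    using assms by (simp add: capped_def min_def)
qed

text \<open>Monotone convergence as the cap runs through the naturals. The doubled cap is harmless,
  since the right side is bounded by the uncapped integral at every level.\<close>

lemma ssd_dominatedI_capped:
  assumes \<mu>: "real_distribution \<mu>" "AE x in \<mu>. 0 \<le> x"
    and \<nu>: "real_distribution \<nu>" "AE x in \<nu>. 0 \<le> x"
    and le: "\<And>u m. mono u \<Longrightarrow> convex_on UNIV u \<Longrightarrow> 0 \<le> m \<Longrightarrow>
      (\<integral>x. capped u m x \<partial>\<mu>) \<le> (\<integral>x. capped u (2 * m) x \<partial>\<nu>)"
  shows "ssd_dominated \<mu> \<nu>"
  unfolding ssd_dominated_def
proof (intro allI impI, elim conjE)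
  fix u :: "real \<Rightarrow> real" assume u: "mono u" "convex_on UNIV u"
  interpret \<mu>: real_distribution \<mu> by fact
  interpret \<nu>: real_distribution \<nu> by fact
  have [measurable]: "u \<in> borel_measurable borel"
    using convex_real_continuous[OF u(2), of UNIV] by (rule borel_measurable_continuous_onI)
  have [measurable]: "capped u m \<in> borel_measurable borel" for m
    using continuous_on_capped[OF u(2), of UNIV] by (rule borel_measurable_continuous_onI)
  have ge: "AE x in \<mu>. u 0 \<le> u x" "AE x in \<nu>. u 0 \<le> u x"
    using \<mu>(2) \<nu>(2) by (auto elim!: eventually_mono intro: monoD[OF u(1)])
  have as_capped: "(\<integral>\<^sup>+ x. ennreal (min (u x - u 0) m) \<partial>N) = ennreal (\<integral>x. capped u m x \<partial>N)"
    if N: "real_distribution N" "AE x in N. 0 \<le> x" and "0 \<le> m" for N m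
  proof -
    interpret N: real_distribution N by fact
    have "(\<integral>\<^sup>+ x. ennreal (min (u x - u 0) m) \<partial>N) = (\<integral>\<^sup>+ x. ennreal (capped u m x) \<partial>N)"
      using N(2) by (intro nn_integral_cong_AE) (auto elim!: eventually_mono simp: capped_def)
    also have "\<dots> = ennreal (\<integral>x. capped u m x \<partial>N)"
      using capped_nonneg[OF u(1) \<open>0 \<le> m\<close>] capped_le[of u m]
      by (intro nn_integral_eq_integral N.integrable_const_bound[of _ m]) auto
    finally show ?thesis .
  qed
  have "(\<integral>\<^sup>+ x. ennreal (u x - u 0) \<partial>\<mu>) = (\<integral>\<^sup>+ x. (SUP k. ennreal (min (u x - u 0) (real k))) \<partial>\<mu>)"
  proof (rule nn_integral_cong)
    fix x
    obtain k where "u x - u 0 \<le> real k" using real_arch_simple by blast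
    then have "ennreal (u x - u 0) \<le> (SUP k. ennreal (min (u x - u 0) (real k)))"
      by (intro SUP_upper2[of k]) auto
    then show "ennreal (u x - u 0) = (SUP k. ennreal (min (u x - u 0) (real k)))"
      by (intro antisym SUP_least ennreal_leI) auto
  qed
  also have "\<dots> = (SUP k. \<integral>\<^sup>+ x. ennreal (min (u x - u 0) (real k)) \<partial>\<mu>)"
    by (intro nn_integral_monotone_convergence_SUP) (auto simp: incseq_def le_fun_def intro!: ennreal_leI)
  also have "\<dots> \<le> (\<integral>\<^sup>+ x. ennreal (u x - u 0) \<partial>\<nu>)"
  proof (rule SUP_least)
    fix k :: nat
    have "(\<integral>\<^sup>+ x. ennreal (min (u x - u 0) (real k)) \<partial>\<mu>) = ennreal (\<integral>x. capped u (real k) x \<partial>\<mu>)"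
      by (rule as_capped[OF \<mu>]) simp
    also have "\<dots> \<le> ennreal (\<integral>x. capped u (2 * real k) x \<partial>\<nu>)"
      by (intro ennreal_leI le u) simp
    also have "\<dots> = (\<integral>\<^sup>+ x. ennreal (min (u x - u 0) (2 * real k)) \<partial>\<nu>)"
      by (rule as_capped[OF \<nu>, symmetric]) simp
    also have "\<dots> \<le> (\<integral>\<^sup>+ x. ennreal (u x - u 0) \<partial>\<nu>)"
      by (intro nn_integral_mono ennreal_leI) simp
    finally show "(\<integral>\<^sup>+ x. ennreal (min (u x - u 0) (real k)) \<partial>\<mu>) \<le> (\<integral>\<^sup>+ x. ennreal (u x - u 0) \<partial>\<nu>)" .
  qed
  finally have "enn2ereal (\<integral>\<^sup>+ x. ennreal (u x - u 0) \<partial>\<mu>) \<le> enn2ereal (\<integral>\<^sup>+ x. ennreal (u x - u 0) \<partial>\<nu>)"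
    by (simp add: less_eq_ennreal.rep_eq)
  then show "has_expectation \<mu> u \<and> has_expectation \<nu> u \<and> ext_expectation \<mu> u \<le> ext_expectation \<nu> u"
    using \<mu>.ext_expectation_bounded_below[OF _ ge(1)] \<nu>.ext_expectation_bounded_below[OF _ ge(2)]
    by (auto intro!: add_mono)
qed

section \<open>Bounded test functions and weak limits\<close>

lemma clamped_uniformly_continuous:
  fixes g :: "real \<Rightarrow> real"
  assumes "continuous_on UNIV g" and low: "\<And>x. x \<le> a \<Longrightarrow> g x = g a" and high: "\<And>x. b \<le> x \<Longrightarrow> g x = g b"
    and "a \<le> b"
  shows "uniformly_continuous_on UNIV g"
proof -
  \<comment> \<open>Clamping to the interval is 1-Lipschitz and leaves \<open>g\<close> unchanged,
    so uniform continuity on the compact interval extends to the line.\<close>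
  have clamp: "g (min (max x a) b) = g x" for x
    using low[of x] high[of x] \<open>a \<le> b\<close> by (auto simp: min_def max_def)
  have unif: "uniformly_continuous_on {a..b} g"
    using assms(1) by (intro compact_uniformly_continuous continuous_on_subset[OF assms(1)]) auto
  show ?thesis
    unfolding uniformly_continuous_on_def
  proof (intro allI impI)
    fix e :: real assume "e > 0"
    then obtain d where d: "d > 0"
      "\<And>x y. x \<in> {a..b} \<Longrightarrow> y \<in> {a..b} \<Longrightarrow> dist y x < d \<Longrightarrow> dist (g y) (g x) < e"
      using unif unfolding uniformly_continuous_on_def by metis
    have "dist (g y) (g x) < e" if "dist y x < d" for x y
    proof -
      have "dist (min (max y a) b) (min (max x a) b) \<le> dist y x"
        by (auto simp: dist_real_def min_def max_def)
      then show ?thesis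
        using d(2)[of "min (max x a) b" "min (max y a) b"] that \<open>a \<le> b\<close> by (simp add: clamp)
    qed
    then show "\<exists>d>0. \<forall>x\<in>UNIV. \<forall>y\<in>UNIV. dist y x < d \<longrightarrow> dist (g y) (g x) < e"
      using d(1) by blast
  qed
qed

text \<open>Slutsky's argument: where \<open>U\<close> and \<open>V\<close> are within
  \<open>d\<close> the integrands differ by less than \<open>e / 2\<close>, and on the vanishing
  exceptional event by at most \<open>2 * C\<close>.\<close>

lemma (in prob_space) integral_diff_tendsto_0_in_prob:
  fixes g :: "real \<Rightarrow> real"
  assumes [measurable]: "\<And>k. U k \<in> borel_measurable M" "\<And>k. V k \<in> borel_measurable M"
    and close: "\<And>e. e > 0 \<Longrightarrow> (\<lambda>k. prob {\<omega> \<in> space M. e \<le> \<bar>U k \<omega> - V k \<omega>\<bar>}) \<longlonglongrightarrow> 0"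
    and g: "uniformly_continuous_on UNIV g" and bound: "\<And>x. \<bar>g x\<bar> \<le> C"
  shows "(\<lambda>k. (\<integral>\<omega>. g (U k \<omega>) \<partial>M) - (\<integral>\<omega>. g (V k \<omega>) \<partial>M)) \<longlonglongrightarrow> 0"
proof (rule LIMSEQ_I)
  fix e :: real assume "e > 0"
  have [measurable]: "g \<in> borel_measurable borel"
    using uniformly_continuous_imp_continuous[OF g] by (rule borel_measurable_continuous_onI)
  have "C \<ge> 0" using bound[of 0] by simp
  obtain d where "d > 0" and d: "\<And>x y. \<bar>x - y\<bar> < d \<Longrightarrow> \<bar>g x - g y\<bar> < e / 2"
    using g \<open>e > 0\<close> unfolding uniformly_continuous_on_def dist_real_def
    by (metis UNIV_I half_gt_zero_iff)
  have int: "integrable M (\<lambda>\<omega>. g (W \<omega>))" if [measurable]: "W \<in> borel_measurable M" for W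
    using bound by (intro integrable_const_bound[of _ C]) auto
  define p where "p k = prob {\<omega> \<in> space M. d \<le> \<bar>U k \<omega> - V k \<omega>\<bar>}" for k
  have le: "\<bar>(\<integral>\<omega>. g (U k \<omega>) \<partial>M) - (\<integral>\<omega>. g (V k \<omega>) \<partial>M)\<bar> \<le> e / 2 + 2 * C * p k" for k
  proof -
    let ?S = "{\<omega> \<in> space M. d \<le> \<bar>U k \<omega> - V k \<omega>\<bar>}"
    have "\<bar>(\<integral>\<omega>. g (U k \<omega>) \<partial>M) - (\<integral>\<omega>. g (V k \<omega>) \<partial>M)\<bar> = \<bar>\<integral>\<omega>. g (U k \<omega>) - g (V k \<omega>) \<partial>M\<bar>"
      using int by simp
    also have "\<dots> \<le> (\<integral>\<omega>. \<bar>g (U k \<omega>) - g (V k \<omega>)\<bar> \<partial>M)"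
      by (rule integral_abs_bound)
    also have "\<dots> \<le> (\<integral>\<omega>. e / 2 + 2 * C * indicator ?S \<omega> \<partial>M)"
    proof (rule integral_mono)
      show "integrable M (\<lambda>\<omega>. \<bar>g (U k \<omega>) - g (V k \<omega>)\<bar>)" using int by simp
      show "integrable M (\<lambda>\<omega>. e / 2 + 2 * C * indicator ?S \<omega>)"
        by (intro Bochner_Integration.integrable_add integrable_mult_right) (auto simp: emeasure_eq_measure)
      fix \<omega> assume "\<omega> \<in> space M"
      then show "\<bar>g (U k \<omega>) - g (V k \<omega>)\<bar> \<le> e / 2 + 2 * C * indicator ?S \<omega>"
        using d[of "U k \<omega>" "V k \<omega>"] bound[of "U k \<omega>"] bound[of "V k \<omega>"] \<open>e > 0\<close>
        by (auto simp: indicator_def)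
    qed
    also have "\<dots> = e / 2 + 2 * C * p k"
      by (subst Bochner_Integration.integral_add) (auto simp: prob_space p_def emeasure_eq_measure)
    finally show ?thesis .
  qed
  have "(\<lambda>k. 2 * C * p k) \<longlonglongrightarrow> 0"
    using close[OF \<open>d > 0\<close>] unfolding p_def by (rule tendsto_mult_right_zero)
  then obtain n where "\<And>k. k \<ge> n \<Longrightarrow> norm (2 * C * p k - 0) < e / 2"
    using LIMSEQ_D[of _ 0 "e / 2"] \<open>e > 0\<close> by fastforce
  then have "norm ((\<integral>\<omega>. g (U k \<omega>) \<partial>M) - (\<integral>\<omega>. g (V k \<omega>) \<partial>M) - 0) < e" if "k \<ge> n" for k
    using le[of k] that by fastforce
  then show "\<exists>n. \<forall>k\<ge>n. norm ((\<integral>\<omega>. g (U k \<omega>) \<partial>M) - (\<integral>\<omega>. g (V k \<omega>) \<partial>M) - 0) < e"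
    by blast
qed

lemma (in prob_space) weak_limit_integral:
  fixes g :: "real \<Rightarrow> real"
  assumes [measurable]: "\<And>k. U k \<in> borel_measurable M"
    and W: "converges_weakly M U (Law \<mu>)"
    and "continuous_on UNIV g" and "\<And>x. \<bar>g x\<bar> \<le> C"
  shows "(\<lambda>k. \<integral>\<omega>. g (U k \<omega>) \<partial>M) \<longlonglongrightarrow> (\<integral>x. g x \<partial>\<mu>)"
proof -
  have [measurable]: "g \<in> borel_measurable borel"
    using assms(3) by (rule borel_measurable_continuous_onI)
  have "(\<lambda>k. \<integral>x. g x \<partial>distr M borel (U k)) \<longlonglongrightarrow> (\<integral>x. g x \<partial>\<mu>)"
  proof (rule weak_conv_imp_integral_bdd_continuous_conv[where B = C])
    show "real_distribution (distr M borel (U k))" for k by (rule real_distribution_distr) simp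
    show "real_distribution \<mu>" "weak_conv_m (\<lambda>k. distr M borel (U k)) \<mu>" using W by auto
    show "isCont g x" for x using assms(3) by (simp add: continuous_on_eq_continuous_at)
    show "norm (g x) \<le> C" for x using assms(4) by simp
  qed
  then show ?thesis by (simp add: integral_distr)
qed

lemma (in prob_space) weak_limit_nonneg:
  assumes [measurable]: "\<And>k. U k \<in> borel_measurable M" "\<And>k. V k \<in> borel_measurable M"
    and close: "\<And>e. e > 0 \<Longrightarrow> (\<lambda>k. prob {\<omega> \<in> space M. e \<le> \<bar>U k \<omega> - V k \<omega>\<bar>}) \<longlonglongrightarrow> 0"
    and V: "\<And>k \<omega>. 0 \<le> V k \<omega>" and W: "converges_weakly M U (Law \<mu>)"
  shows "AE x in \<mu>. 0 \<le> x"
proof -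
  interpret \<mu>: real_distribution \<mu> using W by simp
  \<comment> \<open>\<open>g\<close> is positive exactly on the negative half-line, so a zero
    integral of \<open>g\<close> says that \<open>\<mu>\<close> has no mass there.\<close>
  define g :: "real \<Rightarrow> real" where "g x = max 0 (min 1 (- x))" for x
  have cont: "continuous_on UNIV g" unfolding g_def by (intro continuous_intros)
  then have [measurable]: "g \<in> borel_measurable borel" by (rule borel_measurable_continuous_onI)
  have bound: "\<bar>g x\<bar> \<le> 1" for x by (auto simp: g_def)
  have unif: "uniformly_continuous_on UNIV g"
    using cont by (rule clamped_uniformly_continuous[where a = "-1" and b = 0]) (auto simp: g_def)
  have "(\<lambda>k. (\<integral>\<omega>. g (U k \<omega>) \<partial>M) - (\<integral>\<omega>. g (V k \<omega>) \<partial>M)) \<longlonglongrightarrow> 0"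
    using close unif bound by (intro integral_diff_tendsto_0_in_prob[where C = 1]) auto
  moreover have "(\<integral>\<omega>. g (V k \<omega>) \<partial>M) = 0" for k
  proof -
    have "g (V k \<omega>) = 0" for \<omega> using V[of k \<omega>] by (simp add: g_def)
    then show ?thesis by simp
  qed
  ultimately have "(\<lambda>k. \<integral>\<omega>. g (U k \<omega>) \<partial>M) \<longlonglongrightarrow> 0" by simp
  moreover have "(\<lambda>k. \<integral>\<omega>. g (U k \<omega>) \<partial>M) \<longlonglongrightarrow> (\<integral>x. g x \<partial>\<mu>)"
    using W cont bound by (intro weak_limit_integral) auto
  ultimately have "(\<integral>x. g x \<partial>\<mu>) = 0" using LIMSEQ_unique by blast
  moreover have "integrable \<mu> g" using bound by (intro \<mu>.integrable_const_bound[of _ 1]) auto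
  ultimately have "AE x in \<mu>. g x = 0"
    by (subst (asm) integral_nonneg_eq_0_iff_AE) (auto simp: g_def)
  then show ?thesis by eventually_elim (auto simp: g_def split: if_splits)
qed

lemma (in prob_space) weak_limit_not_Plus_Inf:
  assumes [measurable]: "\<And>k. U k \<in> borel_measurable M"
    and inf: "converges_weakly M U Plus_Inf"
  shows "\<not> converges_weakly M U (Law \<mu>)" "\<not> converges_weakly M U Minus_Inf"
proof -
  have gt: "(\<lambda>k. prob {\<omega> \<in> space M. U k \<omega> > c}) \<longlonglongrightarrow> 1" for c using inf by simp
  have compl: "prob {\<omega> \<in> space M. U k \<omega> \<le> c} = 1 - prob {\<omega> \<in> space M. U k \<omega> > c}" for k c
    by (subst prob_compl[symmetric]) (auto intro!: arg_cong[where f = prob])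
  have le: "(\<lambda>k. prob {\<omega> \<in> space M. U k \<omega> \<le> c}) \<longlonglongrightarrow> 0" for c
    unfolding compl using tendsto_diff[OF tendsto_const gt[of c], of 1] by simp
  show "\<not> converges_weakly M U Minus_Inf"
  proof
    assume "converges_weakly M U Minus_Inf"
    then have "(\<lambda>k. prob {\<omega> \<in> space M. U k \<omega> < 0}) \<longlonglongrightarrow> 1" by simp
    then have "1 \<le> (0::real)"
      by (rule LIMSEQ_le[OF _ le[of 0]]) (auto intro!: finite_measure_mono)
    then show False by simp
  qed
  show "\<not> converges_weakly M U (Law \<mu>)"
  proof
    assume W: "converges_weakly M U (Law \<mu>)"
    then interpret \<mu>: real_distribution \<mu> by simp
    have "cdf \<mu> c \<le> 0" for c
    proof -
      \<comment> \<open>The ramp from 1 at \<open>c\<close> to 0 at \<open>c + 1\<close> lies above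
        the indicator defining \<open>cdf \<mu> c\<close> and below that of
        \<open>U k \<le> c + 1\<close>, so continuity points of the cdf need no attention.\<close>
      define g :: "real \<Rightarrow> real" where "g = cts_step c (c + 1)"
      have cont: "continuous_on UNIV g"
        unfolding g_def by (intro uniformly_continuous_imp_continuous cts_step_uniformly_continuous) simp
      then have [measurable]: "g \<in> borel_measurable borel" by (rule borel_measurable_continuous_onI)
      have bound: "0 \<le> g x" "g x \<le> 1" for x by (auto simp: g_def cts_step_def)
      have "(\<integral>\<omega>. g (U k \<omega>) \<partial>M) \<le> prob {\<omega> \<in> space M. U k \<omega> \<le> c + 1}" for k
      proof -
        have "(\<integral>\<omega>. g (U k \<omega>) \<partial>M) \<le> (\<integral>\<omega>. indicator {\<omega> \<in> space M. U k \<omega> \<le> c + 1} \<omega> \<partial>M)"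
          using bound by (intro integral_mono integrable_const_bound[of _ 1])
            (auto simp: indicator_def g_def cts_step_def)
        then show ?thesis by simp
      qed
      moreover have "(\<lambda>k. \<integral>\<omega>. g (U k \<omega>) \<partial>M) \<longlonglongrightarrow> (\<integral>x. g x \<partial>\<mu>)"
        using W cont bound by (intro weak_limit_integral[where C = 1]) auto
      ultimately have "(\<integral>x. g x \<partial>\<mu>) \<le> 0"
        by (intro LIMSEQ_le[OF _ le[of "c + 1"]]) auto
      then show ?thesis using \<mu>.cdf_cts_step(1)[of c "c + 1"] by (simp add: g_def)
    qed
    then have "1 \<le> (0::real)"
      using \<mu>.cdf_lim_at_top_prob by (intro tendsto_upperbound[of "cdf \<mu>"]) auto
    then show False by simp
  qed
qed

section \<open>The optimality gap of perturbed solutions\<close>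

lemma weak_limit_subseq:
  assumes "converges_weakly M U W" "strict_mono (r :: nat \<Rightarrow> nat)"
  shows "converges_weakly M (\<lambda>k. U (r k)) W"
proof -
  have sub: "(\<lambda>k. f (r k)) \<longlonglongrightarrow> l" if "f \<longlonglongrightarrow> l" for f and l :: real
    using LIMSEQ_subseq_LIMSEQ[OF that assms(2)] by (simp add: comp_def)
  show ?thesis
  proof (cases W)
    case Minus_Inf
    with assms(1) show ?thesis
      by (auto intro: sub[of "\<lambda>n. measure M {\<omega> \<in> space M. U n \<omega> < _}"])
  next
    case (Law \<mu>)
    with assms(1) show ?thesis
      by (auto simp: weak_conv_m_def weak_conv_def intro: sub[of "\<lambda>n. cdf (distr M borel (U n)) _"])
  next
    case Plus_Inf
    with assms(1) show ?thesis
      by (auto intro: sub[of "\<lambda>n. measure M {\<omega> \<in> space M. _ < U n \<omega>}"])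
  qed
qed

lemma weak_limit_cong:
  assumes "\<And>k \<omega>. \<omega> \<in> space M \<Longrightarrow> U k \<omega> = V k \<omega>"
  shows "converges_weakly M U W \<longleftrightarrow> converges_weakly M V W"
proof -
  have "{\<omega> \<in> space M. U k \<omega> < c} = {\<omega> \<in> space M. V k \<omega> < c}"
    "{\<omega> \<in> space M. c < U k \<omega>} = {\<omega> \<in> space M. c < V k \<omega>}" for c k
    using assms by auto
  moreover have "distr M borel (U k) = distr M borel (V k)" for k
    using assms by (intro distr_cong) auto
  ultimately show ?thesis by (cases W) simp_all
qed

text \<open>If absolute values do not diverge, infinitely many terms share a bound and
  Bolzano-Weierstrass applies to them. Applied to \<open>sqrt n * lam n\<close>, this separates the
  two regimes.\<close>

lemma real_subseq_cases:
  fixes s :: "nat \<Rightarrow> real"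
  obtains r c where "strict_mono (r :: nat \<Rightarrow> nat)" "(\<lambda>k. s (r k)) \<longlonglongrightarrow> c"
  | r where "strict_mono (r :: nat \<Rightarrow> nat)" "filterlim (\<lambda>k. \<bar>s (r k)\<bar>) at_top sequentially"
proof (cases "filterlim (\<lambda>k. \<bar>s k\<bar>) at_top sequentially")
  case True
  then show ?thesis using that(2)[of id] by (simp add: strict_mono_def)
next
  case False
  then obtain B where "\<not> (\<forall>\<^sub>F k in sequentially. B < \<bar>s k\<bar>)"
    unfolding filterlim_at_top_dense by blast
  then have inf: "infinite {k. \<bar>s k\<bar> \<le> B}"
    by (simp add: not_eventually not_less cofinite_eq_sequentially[symmetric] frequently_cofinite)
  define r where "r = enumerate {k. \<bar>s k\<bar> \<le> B}"
  have r: "strict_mono r" using inf by (simp add: r_def strict_mono_enumerate)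
  have "\<bar>s (r k)\<bar> \<le> B" for k
    using enumerate_in_set[OF inf, of k] by (simp add: r_def)
  then have "s (r k) \<in> {-B..B}" for k
    using abs_le_iff[of "s (r k)" B] by (simp add: minus_le_iff)
  moreover have "seq_compact {-B..B}" by (simp add: compact_imp_seq_compact)
  ultimately obtain c r' where r': "strict_mono r'" and lim: "((\<lambda>k. s (r k)) \<circ> r') \<longlonglongrightarrow> c"
    unfolding seq_compact_def by metis
  then show ?thesis
    using that(1)[OF strict_mono_o[OF r r'], of c] lim by (simp add: comp_def)
qed

lemma sum_of_squares_facts:
  fixes q :: "'b::euclidean_space \<Rightarrow> real"
  assumes q: "\<And>v. q v = (\<Sum>a\<leftarrow>as. (a \<bullet> v)\<^sup>2)"
  shows sum_of_squares_nonneg: "0 \<le> q v"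
    and sum_of_squares_scale: "q (t *\<^sub>R v) = t\<^sup>2 * q v"
    and sum_of_squares_continuous: "continuous_on UNIV q"
    and sum_of_squares_parallelogram: "q (y + v) + q (- y + v) = 2 * q y + 2 * q v"
proof -
  have eq: "q = (\<lambda>v. \<Sum>a\<leftarrow>as. (a \<bullet> v)\<^sup>2)" using q by blast
  show "0 \<le> q v" unfolding eq by (rule sum_list_nonneg) auto
  show "q (t *\<^sub>R v) = t\<^sup>2 * q v"
    unfolding eq by (induction as) (auto simp: power_mult_distrib distrib_left)
  show "continuous_on UNIV q"
    unfolding eq by (induction as) (auto intro!: continuous_intros)
  show "q (y + v) + q (- y + v) = 2 * q y + 2 * q v"
    unfolding eq
    by (induction as) (auto simp: inner_add_right inner_diff_right power2_eq_square algebra_simps)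
qed

text \<open>\<open>sol n l\<close> is the solution with sample size \<open>n\<close> and tuning parameter \<open>l\<close>; \<open>e n\<close> is the
  remainder of its expansion divided by \<open>1 / \<surd>n + \<bar>l\<bar>\<close>.\<close>

locale perturbed_solution = centered_iid M X
  for M :: "'w measure" and X :: "nat \<Rightarrow> 'w \<Rightarrow> 'b::euclidean_space" +
  fixes sol :: "nat \<Rightarrow> real \<Rightarrow> 'w \<Rightarrow> 'b" and Z q :: "'b \<Rightarrow> real" and x\<^sub>0 K :: 'b and as :: "'b list"
  assumes Taylor: "\<And>\<epsilon>. \<epsilon> > 0 \<Longrightarrow> \<exists>\<delta>>0. \<forall>x. norm (x - x\<^sub>0) < \<delta> \<longrightarrow>
      \<bar>Z x - Z x\<^sub>0 - q (x - x\<^sub>0) / 2\<bar> \<le> \<epsilon> * (norm (x - x\<^sub>0))\<^sup>2"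
    and q: "\<And>v. q v = (\<Sum>a\<leftarrow>as. (a \<bullet> v)\<^sup>2)"
    and qK: "q K > 0"
    and measurable_Z_sol: "\<And>n l. n \<ge> 1 \<Longrightarrow> (\<lambda>\<omega>. Z (sol n l \<omega>)) \<in> borel_measurable M"
    and expansion: "\<And>ls. ls \<longlonglongrightarrow> 0 \<Longrightarrow> \<exists>e. (\<forall>n\<ge>1. e n \<in> borel_measurable M) \<and>
      (\<forall>n\<ge>1. \<forall>\<omega>\<in>space M. sqrt (real n) *\<^sub>R (sol n (ls n) \<omega> - x\<^sub>0) = normalized_sum n \<omega> +
        (sqrt (real n) * ls n) *\<^sub>R K + (1 + \<bar>sqrt (real n) * ls n\<bar>) *\<^sub>R e n \<omega>) \<and>
      (\<forall>\<delta>>0. (\<lambda>n. prob {\<omega> \<in> space M. norm (e n \<omega>) > \<delta>}) \<longlonglongrightarrow> 0)"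
begin

definition gap :: "(nat \<Rightarrow> real) \<Rightarrow> nat \<Rightarrow> 'w \<Rightarrow> real" where
  "gap ls n \<omega> = real n * (Z (sol n (ls n) \<omega>) - Z x\<^sub>0)"

lemma measurable_gap[measurable]: "gap ls n \<in> borel_measurable M"
proof (cases "n = 0")
  case False
  then have [measurable]: "(\<lambda>\<omega>. Z (sol n (ls n) \<omega>)) \<in> borel_measurable M"
    by (intro measurable_Z_sol) simp
  show ?thesis unfolding gap_def by measurable
\<comment> \<open>At \<open>n = 0\<close> the factor \<open>real n\<close> makes the gap the
  constant 0, whereas measurability of the solution's objective is given from \<open>n = 1\<close>
  on.\<close>
qed (simp add: gap_def[abs_def])

lemmas q_nonneg = sum_of_squares_nonneg[OF q]
  and q_scale = sum_of_squares_scale[OF q]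
  and q_continuous = sum_of_squares_continuous[OF q]
  and q_parallelogram = sum_of_squares_parallelogram[OF q]

lemma measurable_q[measurable]: "q \<in> borel_measurable borel"
  using q_continuous by (rule borel_measurable_continuous_onI)

lemma normalized_sum_eventually_bounded:
  assumes "\<eta> > 0"
  obtains R where "R > 0" "\<And>n. n \<ge> 1 \<Longrightarrow> prob {\<omega> \<in> space M. norm (normalized_sum n \<omega>) > R} < \<eta>"
proof -
  obtain V where V: "\<And>n R. n \<ge> 1 \<Longrightarrow> R > 0 \<Longrightarrow>
      prob {\<omega> \<in> space M. norm (normalized_sum n \<omega>) > R} \<le> V / R\<^sup>2"
    using normalized_sum_tight by blast
  \<comment> \<open>This yields \<open>V / R\<^sup>2 = V * \<eta> / (|V| + 1)\<close>, below
    \<open>\<eta>\<close> whatever the sign of \<open>V\<close>.\<close>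
  define R where "R = sqrt ((\<bar>V\<bar> + 1) / \<eta>)"
  have "R > 0" using assms by (simp add: R_def)
  have "V / R\<^sup>2 = V * \<eta> / (\<bar>V\<bar> + 1)" using assms by (simp add: R_def)
  also have "\<dots> < \<eta>"
  proof -
    have "V * \<eta> < (\<bar>V\<bar> + 1) * \<eta>" using assms by (intro mult_strict_right_mono) auto
    then show ?thesis by (simp add: pos_divide_less_eq mult.commute)
  qed
  finally show ?thesis using V \<open>R > 0\<close> that by (meson order_le_less_trans)
qed

text \<open>The bridge from deterministic estimates to probabilities: a bad event forces the
  normalized sum out of its ball or the rescaled remainder out of its own, and a union bound spends
  \<open>\<eta> / 2\<close> on each. Keeping \<open>bad\<close> abstract lets one argument serve
  closeness, boundedness and divergence of the gap.\<close>

lemma bad_event_unlikely: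
  assumes r: "strict_mono r" and ls: "ls \<longlonglongrightarrow> 0" and "\<eta> > 0"
    and bound: "\<And>n. n \<ge> 1 \<Longrightarrow> prob {\<omega> \<in> space M. norm (normalized_sum n \<omega>) > R} < \<eta> / 2"
    and good: "\<exists>\<delta>>0. \<forall>\<^sub>F k in sequentially. \<forall>x y e. norm y \<le> R \<and> norm e \<le> \<delta> \<and>
      sqrt (real (r k)) *\<^sub>R (x - x\<^sub>0) = y + (sqrt (real (r k)) * ls (r k)) *\<^sub>R K +
        (1 + \<bar>sqrt (real (r k)) * ls (r k)\<bar>) *\<^sub>R e \<longrightarrow>
      \<not> bad k y (real (r k) * (Z x - Z x\<^sub>0))"
  shows "\<forall>\<^sub>F k in sequentially.
    prob {\<omega> \<in> space M. bad k (normalized_sum (r k) \<omega>) (gap ls (r k) \<omega>)} < \<eta>"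
proof -
  obtain e where
    e: "\<And>n. n \<ge> 1 \<Longrightarrow> e n \<in> borel_measurable M"
      "\<And>n \<omega>. n \<ge> 1 \<Longrightarrow> \<omega> \<in> space M \<Longrightarrow>
        sqrt (real n) *\<^sub>R (sol n (ls n) \<omega> - x\<^sub>0) = normalized_sum n \<omega> +
          (sqrt (real n) * ls n) *\<^sub>R K + (1 + \<bar>sqrt (real n) * ls n\<bar>) *\<^sub>R e n \<omega>"
      "\<And>\<delta>. \<delta> > 0 \<Longrightarrow> (\<lambda>n. prob {\<omega> \<in> space M. norm (e n \<omega>) > \<delta>}) \<longlonglongrightarrow> 0"
    using expansion[OF ls] by blast
  obtain \<delta> where "\<delta> > 0" and good': "\<forall>\<^sub>F k in sequentially. \<forall>x y e. norm y \<le> R \<and> norm e \<le> \<delta> \<and>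
      sqrt (real (r k)) *\<^sub>R (x - x\<^sub>0) = y + (sqrt (real (r k)) * ls (r k)) *\<^sub>R K +
        (1 + \<bar>sqrt (real (r k)) * ls (r k)\<bar>) *\<^sub>R e \<longrightarrow>
      \<not> bad k y (real (r k) * (Z x - Z x\<^sub>0))"
    using good by blast
  have "(\<lambda>k. prob {\<omega> \<in> space M. norm (e (r k) \<omega>) > \<delta>}) \<longlonglongrightarrow> 0"
    using LIMSEQ_subseq_LIMSEQ[OF e(3)[OF \<open>\<delta> > 0\<close>] r] by (simp add: comp_def)
  from order_tendstoD(2)[OF this, of "\<eta> / 2"] \<open>\<eta> > 0\<close>
  have small: "\<forall>\<^sub>F k in sequentially. prob {\<omega> \<in> space M. norm (e (r k) \<omega>) > \<delta>} < \<eta> / 2" by simp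
  \<comment> \<open>A strictly increasing index satisfies \<open>k \<le> r k\<close>; index 0 must
    be left behind because the expansion starts at 1.\<close>
  have "\<forall>\<^sub>F k in sequentially. r k \<ge> 1"
    using seq_suble[OF r] by (intro eventually_sequentiallyI[of 1]) (meson order_trans)
  with small good' show ?thesis
  proof eventually_elim
    fix k
    let ?A = "{\<omega> \<in> space M. norm (normalized_sum (r k) \<omega>) > R}"
    let ?B = "{\<omega> \<in> space M. norm (e (r k) \<omega>) > \<delta>}"
    assume small: "prob ?B < \<eta> / 2"
      and good: "\<forall>x y e. norm y \<le> R \<and> norm e \<le> \<delta> \<and>
        sqrt (real (r k)) *\<^sub>R (x - x\<^sub>0) = y + (sqrt (real (r k)) * ls (r k)) *\<^sub>R K +
          (1 + \<bar>sqrt (real (r k)) * ls (r k)\<bar>) *\<^sub>R e \<longrightarrow>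
        \<not> bad k y (real (r k) * (Z x - Z x\<^sub>0))"
      and "1 \<le> r k"
    note [measurable] = e(1)[OF \<open>1 \<le> r k\<close>]
    have "prob {\<omega> \<in> space M. bad k (normalized_sum (r k) \<omega>) (gap ls (r k) \<omega>)} \<le> prob (?A \<union> ?B)"
    proof (rule finite_measure_mono)
      show "{\<omega> \<in> space M. bad k (normalized_sum (r k) \<omega>) (gap ls (r k) \<omega>)} \<subseteq> ?A \<union> ?B"
        using good e(2)[OF \<open>1 \<le> r k\<close>] unfolding gap_def by (auto simp: not_less) (meson not_less)
    qed measurable
    also have "\<dots> \<le> prob ?A + prob ?B"
      by (intro measure_Un_le) measurable
    also have "\<dots> < \<eta>" using small bound[OF \<open>1 \<le> r k\<close>] by linarith
    finally show "prob {\<omega> \<in> space M. bad k (normalized_sum (r k) \<omega>) (gap ls (r k) \<omega>)} < \<eta>" .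
  qed
qed

text \<open>The radius \<open>R\<close> depends on the tolerated probability and
  \<open>\<delta>\<close> on \<open>R\<close>, so the estimate is required for every
  \<open>R\<close>.\<close>

lemma bad_event_vanishing:
  assumes "strict_mono r" "ls \<longlonglongrightarrow> 0"
    and "\<And>R. R > 0 \<Longrightarrow> \<exists>\<delta>>0. \<forall>\<^sub>F k in sequentially. \<forall>x y e. norm y \<le> R \<and> norm e \<le> \<delta> \<and>
      sqrt (real (r k)) *\<^sub>R (x - x\<^sub>0) = y + (sqrt (real (r k)) * ls (r k)) *\<^sub>R K +
        (1 + \<bar>sqrt (real (r k)) * ls (r k)\<bar>) *\<^sub>R e \<longrightarrow>
      \<not> bad k y (real (r k) * (Z x - Z x\<^sub>0))"
  shows "(\<lambda>k. prob {\<omega> \<in> space M. bad k (normalized_sum (r k) \<omega>) (gap ls (r k) \<omega>)}) \<longlonglongrightarrow> 0"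
proof (rule order_tendstoI)
  fix \<eta> :: real assume "0 < \<eta>"
  then have "\<eta> / 2 > 0" by simp
  from normalized_sum_eventually_bounded[OF this] obtain R where
    "R > 0" "\<And>n. n \<ge> 1 \<Longrightarrow> prob {\<omega> \<in> space M. norm (normalized_sum n \<omega>) > R} < \<eta> / 2" by blast
  note R = this
  show "\<forall>\<^sub>F k in sequentially.
      prob {\<omega> \<in> space M. bad k (normalized_sum (r k) \<omega>) (gap ls (r k) \<omega>)} < \<eta>"
    by (rule bad_event_unlikely[OF assms(1,2) \<open>0 < \<eta>\<close> R(2) assms(3)[OF R(1)]])
qed (auto intro!: always_eventually less_le_trans[OF _ measure_nonneg])

lemma filterlim_subseq_real: "strict_mono r \<Longrightarrow> filterlim (\<lambda>k. real (r k)) at_top sequentially"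
  using filterlim_compose[OF filterlim_real_sequentially filterlim_subseq] .

section \<open>Scaled perturbation with a finite limit\<close>

context
  fixes r :: "nat \<Rightarrow> nat" and ls :: "nat \<Rightarrow> real" and c :: real
  assumes r: "strict_mono r" and ls: "ls \<longlonglongrightarrow> 0"
    and c: "(\<lambda>k. sqrt (real (r k)) * ls (r k)) \<longlonglongrightarrow> c"
begin

lemma gap_near_quadratic_in_prob:
  assumes "e > 0"
  shows "(\<lambda>k. prob {\<omega> \<in> space M.
    e \<le> \<bar>gap ls (r k) \<omega> - q (normalized_sum (r k) \<omega> + c *\<^sub>R K) / 2\<bar>}) \<longlonglongrightarrow> 0"
  using scaled_gap_near_quadratic[OF Taylor q_scale q_continuous filterlim_subseq_real[OF r] c _ assms]
  by (intro bad_event_vanishing[OF r ls, where bad = "\<lambda>k y g. e \<le> \<bar>g - q (y + c *\<^sub>R K) / 2\<bar>"])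
    (simp add: not_le)

text \<open>One ball suffices: if the gap stays within \<open>C\<close> with probability above 1/2,
  its mass cannot escape to either infinity.\<close>

lemma gap_not_infinite:
  assumes "converges_weakly M (\<lambda>k. gap ls (r k)) W"
  obtains \<mu> where "W = Law \<mu>"
proof -
  obtain R where "R > 0" and
    R: "\<And>n. n \<ge> 1 \<Longrightarrow> prob {\<omega> \<in> space M. norm (normalized_sum n \<omega>) > R} < (1 / 2) / 2"
    using normalized_sum_eventually_bounded[of "(1 / 2) / 2"] by auto
  define R' where "R' = R + norm (c *\<^sub>R K)"
  have "compact (q ` cball 0 R')"
    using continuous_on_subset[OF q_continuous] by (intro compact_continuous_image) auto
  then obtain B where B: "\<And>v. norm v \<le> R' \<Longrightarrow> \<bar>q v\<bar> \<le> B"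
    using compact_imp_bounded bounded_iff by (metis imageI mem_cball_0 real_norm_def)
  define C where "C = B / 2 + 1"
  obtain \<delta> where "\<delta> > 0" and
    \<delta>: "\<forall>\<^sub>F k in sequentially. \<forall>x y e. norm y \<le> R \<and> norm e \<le> \<delta> \<and>
      sqrt (real (r k)) *\<^sub>R (x - x\<^sub>0) = y + (sqrt (real (r k)) * ls (r k)) *\<^sub>R K +
        (1 + \<bar>sqrt (real (r k)) * ls (r k)\<bar>) *\<^sub>R e \<longrightarrow>
      \<bar>real (r k) * (Z x - Z x\<^sub>0) - q (y + c *\<^sub>R K) / 2\<bar> < 1"
    using scaled_gap_near_quadratic[OF Taylor q_scale q_continuous filterlim_subseq_real[OF r] c \<open>R > 0\<close>,
        where \<epsilon> = 1] by auto
  have "\<bar>g\<bar> < C" if "norm y \<le> R" "\<bar>g - q (y + c *\<^sub>R K) / 2\<bar> < 1" for y g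
    using that B[of "y + c *\<^sub>R K"] norm_triangle_ineq[of y "c *\<^sub>R K"] unfolding C_def R'_def by linarith
  then have "\<forall>\<^sub>F k in sequentially. \<forall>x y e. norm y \<le> R \<and> norm e \<le> \<delta> \<and>
      sqrt (real (r k)) *\<^sub>R (x - x\<^sub>0) = y + (sqrt (real (r k)) * ls (r k)) *\<^sub>R K +
        (1 + \<bar>sqrt (real (r k)) * ls (r k)\<bar>) *\<^sub>R e \<longrightarrow>
      \<not> C \<le> \<bar>real (r k) * (Z x - Z x\<^sub>0)\<bar>"
    using \<delta> by (elim eventually_mono) (meson not_le)
  with \<open>\<delta> > 0\<close> have ev: "\<forall>\<^sub>F k in sequentially. prob {\<omega> \<in> space M. C \<le> \<bar>gap ls (r k) \<omega>\<bar>} < 1 / 2"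
    using bad_event_unlikely[OF r ls _ R, where bad = "\<lambda>k y g. C \<le> \<bar>g\<bar>"] by auto
  have no: False if lim: "(\<lambda>k. prob {\<omega> \<in> space M. Q (gap ls (r k) \<omega>)}) \<longlonglongrightarrow> 1"
    and Q: "\<And>g. Q g \<Longrightarrow> C \<le> \<bar>g\<bar>" for Q
  proof -
    have "\<forall>\<^sub>F k in sequentially. prob {\<omega> \<in> space M. Q (gap ls (r k) \<omega>)} > 1 / 2"
      using order_tendstoD(1)[OF lim, of "1 / 2"] by simp
    with ev have "\<forall>\<^sub>F k in sequentially. False"
    proof eventually_elim
      fix k
      assume "prob {\<omega> \<in> space M. C \<le> \<bar>gap ls (r k) \<omega>\<bar>} < 1 / 2"
        and "prob {\<omega> \<in> space M. Q (gap ls (r k) \<omega>)} > 1 / 2"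
      moreover have "prob {\<omega> \<in> space M. Q (gap ls (r k) \<omega>)} \<le> prob {\<omega> \<in> space M. C \<le> \<bar>gap ls (r k) \<omega>\<bar>}"
        using Q by (intro finite_measure_mono) auto
      ultimately show False by linarith
    qed
    then show False by simp
  qed
  show ?thesis
  proof (cases W)
    case Minus_Inf
    with assms have "(\<lambda>k. prob {\<omega> \<in> space M. gap ls (r k) \<omega> < - C}) \<longlonglongrightarrow> 1" by simp
    then have False by (rule no) linarith
    then show ?thesis ..
  next
    case Plus_Inf
    with assms have "(\<lambda>k. prob {\<omega> \<in> space M. C < gap ls (r k) \<omega>}) \<longlonglongrightarrow> 1" by simp
    then have False by (rule no) linarith
    then show ?thesis ..
  qed (rule that)
qed

context
  fixes \<mu> :: "real measure"
  assumes \<mu>: "converges_weakly M (\<lambda>k. gap ls (r k)) (Law \<mu>)"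
begin

lemma limit_law_nonneg: "AE x in \<mu>. 0 \<le> x"
  using gap_near_quadratic_in_prob \<mu> q_nonneg
  by (intro weak_limit_nonneg[of "\<lambda>k. gap ls (r k)"
        "\<lambda>k \<omega>. q (normalized_sum (r k) \<omega> + c *\<^sub>R K) / 2"]) auto

text \<open>Although \<open>\<mu>\<close> arises along \<open>r\<close>, both limits run over all
  \<open>n\<close>: the limit for the quadratic form is known to exist on the whole sequence, and
  \<open>r\<close> only identifies its value. This allows laws found along different subsequences to
  be compared.\<close>

lemma limit_law_capped:
  assumes u: "mono u" "convex_on UNIV u" and "0 \<le> m"
  shows "(\<lambda>n. \<integral>\<omega>. capped u m (q (normalized_sum n \<omega> + c *\<^sub>R K) / 2) \<partial>M) \<longlonglongrightarrow> (\<integral>x. capped u m x \<partial>\<mu>)"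
    "(\<lambda>n. \<integral>\<omega>. capped u m (q (- normalized_sum n \<omega> + c *\<^sub>R K) / 2) \<partial>M) \<longlonglongrightarrow> (\<integral>x. capped u m x \<partial>\<mu>)"
proof -
  obtain B where "0 \<le> B" and B: "\<And>x. B \<le> x \<Longrightarrow> capped u m x = capped u m B"
    using capped_eventually_constant[OF u] by blast
  have bound: "\<bar>capped u m x\<bar> \<le> m" for x
    using capped_nonneg[OF u(1) \<open>0 \<le> m\<close>] capped_le by simp
  have unif: "uniformly_continuous_on UNIV (capped u m)"
  proof (rule clamped_uniformly_continuous[OF continuous_on_capped[OF u(2)] _ B \<open>0 \<le> B\<close>])
    show "capped u m x = capped u m 0" if "x \<le> 0" for x
      using that by (simp add: capped_def max_absorb2)
  qed
  have "symmetric_limit M normalized_sum (\<lambda>y. capped u m (q (y + c *\<^sub>R K) / 2))"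
    by (rule symmetric_limit_sum_of_squares[OF measurable_normalized_sum
          symmetric_limit_char_normalized_sum q continuous_on_capped[OF u(2)] B \<open>0 \<le> B\<close>])
  then obtain l where
    l: "(\<lambda>n. \<integral>\<omega>. capped u m (q (normalized_sum n \<omega> + c *\<^sub>R K) / 2) \<partial>M) \<longlonglongrightarrow> l"
      "(\<lambda>n. \<integral>\<omega>. capped u m (q (- normalized_sum n \<omega> + c *\<^sub>R K) / 2) \<partial>M) \<longlonglongrightarrow> l"
    unfolding symmetric_limit_def by blast
  have "(\<lambda>k. (\<integral>\<omega>. capped u m (gap ls (r k) \<omega>) \<partial>M) -
      (\<integral>\<omega>. capped u m (q (normalized_sum (r k) \<omega> + c *\<^sub>R K) / 2) \<partial>M)) \<longlonglongrightarrow> 0"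
    using gap_near_quadratic_in_prob unif bound
    by (intro integral_diff_tendsto_0_in_prob[where C = m]) auto
  moreover have "(\<lambda>k. \<integral>\<omega>. capped u m (gap ls (r k) \<omega>) \<partial>M) \<longlonglongrightarrow> (\<integral>x. capped u m x \<partial>\<mu>)"
    using \<mu> continuous_on_capped[OF u(2)] bound by (intro weak_limit_integral) auto
  ultimately have "(\<lambda>k. \<integral>\<omega>. capped u m (q (normalized_sum (r k) \<omega> + c *\<^sub>R K) / 2) \<partial>M)
      \<longlonglongrightarrow> (\<integral>x. capped u m x \<partial>\<mu>) - 0"
    using tendsto_diff by fastforce
  moreover have "(\<lambda>k. \<integral>\<omega>. capped u m (q (normalized_sum (r k) \<omega> + c *\<^sub>R K) / 2) \<partial>M) \<longlonglongrightarrow> l"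
    using LIMSEQ_subseq_LIMSEQ[OF l(1) r] by (simp add: comp_def)
  ultimately have "l = (\<integral>x. capped u m x \<partial>\<mu>)" using LIMSEQ_unique by fastforce
  with l show "(\<lambda>n. \<integral>\<omega>. capped u m (q (normalized_sum n \<omega> + c *\<^sub>R K) / 2) \<partial>M) \<longlonglongrightarrow> (\<integral>x. capped u m x \<partial>\<mu>)"
    "(\<lambda>n. \<integral>\<omega>. capped u m (q (- normalized_sum n \<omega> + c *\<^sub>R K) / 2) \<partial>M) \<longlonglongrightarrow> (\<integral>x. capped u m x \<partial>\<mu>)"
    by simp_all
qed

end

end

section \<open>Scaled perturbation escaping to infinity\<close>

lemma gap_tends_to_Plus_Inf:
  assumes r: "strict_mono r" and ls: "ls \<longlonglongrightarrow> 0"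
    and inf: "filterlim (\<lambda>k. \<bar>sqrt (real (r k)) * ls (r k)\<bar>) at_top sequentially"
  shows "converges_weakly M (\<lambda>k. gap ls (r k)) Plus_Inf"
proof -
  have "(\<lambda>k. prob {\<omega> \<in> space M. gap ls (r k) \<omega> > C}) \<longlonglongrightarrow> 1" for C
  proof -
    have "(\<lambda>k. ls (r k)) \<longlonglongrightarrow> 0" using LIMSEQ_subseq_LIMSEQ[OF ls r] by (simp add: comp_def)
    then have "(\<lambda>k. prob {\<omega> \<in> space M. gap ls (r k) \<omega> \<le> C}) \<longlonglongrightarrow> 0"
      using scaled_gap_unbounded[OF Taylor q_scale q_continuous filterlim_subseq_real[OF r] _ inf _ qK, of _ C]
      by (intro bad_event_vanishing[OF r ls, where bad = "\<lambda>k y g. g \<le> C"]) (simp add: not_le)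
    from tendsto_diff[OF tendsto_const this, of 1]
    have "(\<lambda>k. 1 - prob {\<omega> \<in> space M. gap ls (r k) \<omega> \<le> C}) \<longlonglongrightarrow> 1" by simp
    moreover have "1 - prob {\<omega> \<in> space M. gap ls (r k) \<omega> \<le> C} = prob {\<omega> \<in> space M. gap ls (r k) \<omega> > C}" for k
      by (subst prob_compl[symmetric]) (auto intro!: arg_cong[where f = prob])
    ultimately show ?thesis by simp
  qed
  then show ?thesis by simp
qed

theorem unperturbed_gap_dominated:
  assumes lam: "lam \<longlonglongrightarrow> 0"
  shows "asymp_ssd_dominated M (gap (\<lambda>_. 0)) (gap lam)"
  unfolding asymp_ssd_dominated_def
proof (intro allI impI, elim conjE)
  fix r0 r1 :: "nat \<Rightarrow> nat" and W0 W1
  assume r0: "strict_mono r0" and r1: "strict_mono r1"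
    and W0: "converges_weakly M (\<lambda>k. gap (\<lambda>_. 0) (r0 k)) W0"
    and W1: "converges_weakly M (\<lambda>k. gap lam (r1 k)) W1"
  \<comment> \<open>Without perturbation the regime is \<open>c = 0\<close>, so the left limit is
    always a genuine law.\<close>
  have s0: "(\<lambda>_. 0::real) \<longlonglongrightarrow> 0" "(\<lambda>k. sqrt (real (r0 k)) * 0) \<longlonglongrightarrow> 0" by simp_all
  obtain \<mu> where \<mu>: "W0 = Law \<mu>" using gap_not_infinite[OF r0 s0 W0] by blast
  note W0' = W0[unfolded \<mu>]
  show "limit_dominated W0 W1"
  \<comment> \<open>\<open>W1\<close> is inherited by every further subsequence, so it can be
    examined along one on which the scaled perturbation settles.\<close>
  proof (rule real_subseq_cases[of "\<lambda>k. sqrt (real (r1 k)) * lam (r1 k)"])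
    fix r assume r: "strict_mono r"
      and inf: "filterlim (\<lambda>k. \<bar>sqrt (real (r1 (r k))) * lam (r1 (r k))\<bar>) at_top sequentially"
    have "converges_weakly M (\<lambda>k. gap lam ((r1 \<circ> r) k)) Plus_Inf"
      using inf by (intro gap_tends_to_Plus_Inf lam strict_mono_o r r1) simp
    moreover have "converges_weakly M (\<lambda>k. gap lam ((r1 \<circ> r) k)) W1"
      using weak_limit_subseq[OF W1 r] by simp
    ultimately have "W1 = Plus_Inf"
      using weak_limit_not_Plus_Inf[of "\<lambda>k. gap lam ((r1 \<circ> r) k)"] by (cases W1) (auto simp del: converges_weakly.simps)
    then show ?thesis by simp
  next
    fix r c assume r: "strict_mono r"
      and c: "(\<lambda>k. sqrt (real (r1 (r k))) * lam (r1 (r k))) \<longlonglongrightarrow> c"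
    have r': "strict_mono (r1 \<circ> r)" using r r1 by (rule strict_mono_o[rotated])
    have c': "(\<lambda>k. sqrt (real ((r1 \<circ> r) k)) * lam ((r1 \<circ> r) k)) \<longlonglongrightarrow> c" using c by simp
    have W1': "converges_weakly M (\<lambda>k. gap lam ((r1 \<circ> r) k)) W1"
      using weak_limit_subseq[OF W1 r] by simp
    obtain \<nu> where \<nu>: "W1 = Law \<nu>" using gap_not_infinite[OF r' lam c' W1'] by blast
    note W1'' = W1'[unfolded \<nu>]
    have "ssd_dominated \<mu> \<nu>"
    proof (rule ssd_dominatedI_capped)
      show "real_distribution \<mu>" "real_distribution \<nu>" using W0' W1'' by auto
      show "AE x in \<mu>. 0 \<le> x" by (rule limit_law_nonneg[OF r0 s0 W0'])
      show "AE x in \<nu>. 0 \<le> x" by (rule limit_law_nonneg[OF r' lam c' W1''])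
      fix u :: "real \<Rightarrow> real" and m :: real
      assume u: "mono u" "convex_on UNIV u" and "0 \<le> m"
      note lim\<mu> = limit_law_capped(1)[OF r0 s0 W0' u \<open>0 \<le> m\<close>]
      have "0 \<le> 2 * m" using \<open>0 \<le> m\<close> by simp
      note lim\<nu> = limit_law_capped[OF r' lam c' W1'' u this]
      have [measurable]: "capped u m' \<in> borel_measurable borel" for m'
        using continuous_on_capped[OF u(2), of UNIV] by (rule borel_measurable_continuous_onI)
      have int: "integrable M (\<lambda>\<omega>. capped u m' (q (U \<omega>) / 2))"
        if [measurable]: "U \<in> borel_measurable M" and "0 \<le> m'" for U m'
        using capped_nonneg[OF u(1) \<open>0 \<le> m'\<close>] capped_le
        by (intro integrable_const_bound[of _ m']) auto
      have ints: "integrable M (\<lambda>\<omega>. capped u m (q (normalized_sum n \<omega> + 0 *\<^sub>R K) / 2))"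
        "integrable M (\<lambda>\<omega>. capped u (2 * m) (q (normalized_sum n \<omega> + c *\<^sub>R K) / 2))"
        "integrable M (\<lambda>\<omega>. capped u (2 * m) (q (- normalized_sum n \<omega> + c *\<^sub>R K) / 2))" for n
        using \<open>0 \<le> m\<close> \<open>0 \<le> 2 * m\<close> by (intro int; measurable)+
      show "(\<integral>x. capped u m x \<partial>\<mu>) \<le> (\<integral>x. capped u (2 * m) x \<partial>\<nu>)"
      proof (rule LIMSEQ_le[OF lim\<mu>])
        \<comment> \<open>The expectations for the sum and its reflection share a limit, so their
          average has it too; the average is what the midpoint inequality bounds at each
          \<open>n\<close>.\<close>
        show "(\<lambda>n. ((\<integral>\<omega>. capped u (2 * m) (q (normalized_sum n \<omega> + c *\<^sub>R K) / 2) \<partial>M) +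
            (\<integral>\<omega>. capped u (2 * m) (q (- normalized_sum n \<omega> + c *\<^sub>R K) / 2) \<partial>M)) / 2)
          \<longlonglongrightarrow> (\<integral>x. capped u (2 * m) x \<partial>\<nu>)"
          using tendsto_divide[OF tendsto_add[OF lim\<nu>] tendsto_const[of 2]] by simp
        have "(\<integral>\<omega>. capped u m (q (normalized_sum n \<omega> + 0 *\<^sub>R K) / 2) \<partial>M) \<le>
          (\<integral>\<omega>. (capped u (2 * m) (q (normalized_sum n \<omega> + c *\<^sub>R K) / 2) +
            capped u (2 * m) (q (- normalized_sum n \<omega> + c *\<^sub>R K) / 2)) / 2 \<partial>M)" for n
        proof (rule integral_mono)
          fix \<omega>
          show "capped u m (q (normalized_sum n \<omega> + 0 *\<^sub>R K) / 2) \<le>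
            (capped u (2 * m) (q (normalized_sum n \<omega> + c *\<^sub>R K) / 2) +
              capped u (2 * m) (q (- normalized_sum n \<omega> + c *\<^sub>R K) / 2)) / 2"
          proof (rule capped_midpoint[OF u \<open>0 \<le> m\<close>])
            show "2 * (q (normalized_sum n \<omega> + 0 *\<^sub>R K) / 2) \<le>
              q (normalized_sum n \<omega> + c *\<^sub>R K) / 2 + q (- normalized_sum n \<omega> + c *\<^sub>R K) / 2"
              using q_parallelogram[of "normalized_sum n \<omega>" "c *\<^sub>R K"] q_nonneg[of "c *\<^sub>R K"]
              unfolding scaleR_zero_left add_0_right by linarith
          qed (simp_all only: q_nonneg divide_nonneg_pos zero_less_numeral)
        qed (intro integrable_divide_zero Bochner_Integration.integrable_add ints)+
        then show "\<exists>N. \<forall>n\<ge>N. (\<integral>\<omega>. capped u m (q (normalized_sum n \<omega> + 0 *\<^sub>R K) / 2) \<partial>M) \<le>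
          ((\<integral>\<omega>. capped u (2 * m) (q (normalized_sum n \<omega> + c *\<^sub>R K) / 2) \<partial>M) +
            (\<integral>\<omega>. capped u (2 * m) (q (- normalized_sum n \<omega> + c *\<^sub>R K) / 2) \<partial>M)) / 2"
          by (simp only: integral_divide_zero Bochner_Integration.integral_add[OF ints(2,3)]) blast
      qed
    qed
    then show ?thesis by (simp add: \<mu> \<nu>)
  qed
qed

end

section \<open>From the statistical model to the abstract setting\<close>

lemma integrable_inner_square_finite_covariance:
  fixes f :: "'a \<Rightarrow> real ^ 'd"
  assumes "finite_covariance P f"
  shows "integrable P (\<lambda>z. (t \<bullet> (f z - integral\<^sup>L P f))\<^sup>2)"
proof -
  have int: "integrable P f"
    and cov: "\<And>i j. integrable P
      (\<lambda>z. (f z $ i - integral\<^sup>L P (\<lambda>z. f z $ i)) * (f z $ j - integral\<^sup>L P (\<lambda>z. f z $ j)))"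
    using assms unfolding finite_covariance_def by blast+
  have nth: "integral\<^sup>L P (\<lambda>z. f z $ i) = integral\<^sup>L P f $ i" for i
    by (rule integral_bounded_linear[OF bounded_linear_vec_nth int])
  \<comment> \<open>The square is a finite linear combination of the integrands of the covariance
    entries.\<close>
  have "(t \<bullet> (f z - integral\<^sup>L P f))\<^sup>2 = (\<Sum>i\<in>UNIV. \<Sum>j\<in>UNIV. t $ i * t $ j *
      ((f z $ i - integral\<^sup>L P f $ i) * (f z $ j - integral\<^sup>L P f $ j)))" for z
    by (simp add: inner_vec_def power2_eq_square sum_product mult.assoc mult.left_commute)
  then show ?thesis using cov by (simp add: nth)
qed

text \<open>The open set \<open>D\<close> around the feasible set gives full derivatives even at a
  minimizer on its boundary. Conditions on solutions start at \<open>n = 1\<close>, from which on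
  the empirical measure is a probability measure; both scaled gaps are 0 at
  \<open>n = 0\<close>.\<close>

theorem theorem1:
  fixes M :: "'w measure" and P :: "'a measure" and \<xi> :: "nat \<Rightarrow> 'w \<Rightarrow> 'a"
    and X D :: "(real ^ 'd) set"
    and \<psi> :: "real ^ 'd \<Rightarrow> 'a measure \<Rightarrow> real" and Z :: "real ^ 'd \<Rightarrow> real"
    and xstar K :: "real ^ 'd"
    and xEO :: "'a measure \<Rightarrow> real ^ 'd"
    and xsol :: "'a measure \<Rightarrow> real \<Rightarrow> real ^ 'd"
    and IF :: "'a \<Rightarrow> real ^ 'd" and lam :: "nat \<Rightarrow> real"
  assumes "prob_space M"
    and iid: "prob_space.indep_vars M (\<lambda>_. P) \<xi> UNIV" "\<And>i. distr M P (\<xi> i) = P"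
    and Z: "\<And>x. Z x = \<psi> x P"
    and domain: "open D" "X \<subseteq> D"
    and EO: "\<And>n. n \<ge> 1 \<Longrightarrow> AE \<omega> in M.
        is_arg_min (\<lambda>x. \<psi> x (empirical P \<xi> n \<omega>)) (\<lambda>x. x \<in> X) (xEO (empirical P \<xi> n \<omega>))"
    and xsol_random_vector: "\<And>n l. n \<ge> 1 \<Longrightarrow> (\<lambda>\<omega>. xsol (empirical P \<xi> n \<omega>) l) \<in> borel_measurable M"
    and xsol_domain: "\<And>n l \<omega>. n \<ge> 1 \<Longrightarrow> \<omega> \<in> space M \<Longrightarrow> xsol (empirical P \<xi> n \<omega>) l \<in> D"
    and minimizer: "is_arg_min Z (\<lambda>x. x \<in> X) xstar"
    and smooth: "twice_differentiable_on Z D"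
    and optimality: "gradient Z xstar = 0" "positive_semidefinite (hessian Z xstar)"
    and IF: "IF \<in> borel_measurable P" "finite_covariance P IF"
    and linearizability: "\<And>ls :: nat \<Rightarrow> real. ls \<longlonglongrightarrow> 0 \<Longrightarrow>
        small_o_prob M (\<lambda>n. linear_remainder P \<xi> xsol xstar IF K n (ls n))
          (\<lambda>n. 1 / sqrt (real n) + \<bar>ls n\<bar>)"
    and xsol_0: "\<And>n \<omega>. n \<ge> 1 \<Longrightarrow> \<omega> \<in> space M \<Longrightarrow>
        xsol (empirical P \<xi> n \<omega>) 0 = xEO (empirical P \<xi> n \<omega>)"
    and nondegeneracy: "K \<bullet> (hessian Z xstar *v K) \<noteq> 0"
    and "lam \<longlonglongrightarrow> 0"
  shows "asymp_ssd_dominated M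
     (\<lambda>n \<omega>. real n * (Z (xEO (empirical P \<xi> n \<omega>)) - Z xstar))
     (\<lambda>n \<omega>. real n * (Z (xsol (empirical P \<xi> n \<omega>) (lam n)) - Z xstar))"
proof -
  interpret prob_space M by fact
  note [measurable] = IF(1)
  have \<xi>[measurable]: "\<xi> i \<in> M \<rightarrow>\<^sub>M P" for i
    using iid(1) unfolding indep_vars_def by auto
  interpret P: prob_space P
    using prob_space_distr[OF \<xi>, of 0] by (simp add: iid(2))
  have int_IF: "integrable P IF" using IF(2) by (simp add: finite_covariance_def)
  define Y where "Y i \<omega> = IF (\<xi> i \<omega>) - integral\<^sup>L P IF" for i \<omega>
  interpret centered_iid M Y
  proof
    show "indep_vars (\<lambda>_. borel) Y UNIV"
      unfolding Y_def by (rule indep_vars_compose2[OF iid(1)]) measurable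
    have "distr M borel (Y i) = distr P borel (\<lambda>z. IF z - integral\<^sup>L P IF)" for i
    proof -
      have "distr M borel (Y i) = distr (distr M P (\<xi> i)) borel (\<lambda>z. IF z - integral\<^sup>L P IF)"
        by (subst distr_distr) (simp_all add: Y_def[abs_def] comp_def)
      then show ?thesis by (simp add: iid(2))
    qed
    then show "distr M borel (Y i) = distr M borel (Y 0)" for i by simp
    fix t :: "real ^ 'd"
    have "expectation (\<lambda>\<omega>. t \<bullet> Y 0 \<omega>) = (\<integral>z. t \<bullet> (IF z - integral\<^sup>L P IF) \<partial>distr M P (\<xi> 0))"
      by (subst integral_distr) (simp_all add: Y_def)
    also have "\<dots> = t \<bullet> (\<integral>z. IF z - integral\<^sup>L P IF \<partial>P)"
      unfolding iid(2) using int_IF by (intro integral_inner_right) simp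
    also have "\<dots> = 0" using int_IF by (simp add: P.prob_space)
    finally show "expectation (\<lambda>\<omega>. t \<bullet> Y 0 \<omega>) = 0" .
    have "integrable (distr M P (\<xi> 0)) (\<lambda>z. (t \<bullet> (IF z - integral\<^sup>L P IF))\<^sup>2)"
      unfolding iid(2) by (rule integrable_inner_square_finite_covariance[OF IF(2)])
    then show "integrable M (\<lambda>\<omega>. (t \<bullet> Y 0 \<omega>)\<^sup>2)"
      by (subst (asm) integrable_distr_eq) (simp_all add: Y_def)
  qed
  define q where "q v = v \<bullet> (hessian Z xstar *v v)" for v
  obtain as where as: "\<And>v. q v = (\<Sum>a\<leftarrow>as. (a \<bullet> v)\<^sup>2)"
    unfolding q_def using psd_matrix_sum_of_squares[OF optimality(2)] by blast
  define sol where "sol n l \<omega> = xsol (empirical P \<xi> n \<omega>) l" for n l \<omega>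
  have pairing: "pairing IF (empirical P \<xi> n \<omega>) P = (1 / sqrt (real n)) *\<^sub>R normalized_sum n \<omega>"
    if "n \<ge> 1" "\<omega> \<in> space M" for n \<omega>
  proof -
    have "pairing IF (empirical P \<xi> n \<omega>) P = (1 / real n) *\<^sub>R (\<Sum>i<n. IF (\<xi> i \<omega>)) - integral\<^sup>L P IF"
      using measurable_space[OF \<xi> \<open>\<omega> \<in> space M\<close>] by (intro pairing_empirical IF(1))
    also have "\<dots> = (1 / real n) *\<^sub>R (\<Sum>i<n. Y i \<omega>)"
      using \<open>n \<ge> 1\<close>
      by (simp add: Y_def sum_subtractf scaleR_diff_right sum_constant_scaleR del: sum_constant)
    also have "\<dots> = (1 / sqrt (real n)) *\<^sub>R normalized_sum n \<omega>"
      by (simp add: normalized_sum_def)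
    finally show ?thesis .
  qed
  interpret perturbed_solution M Y sol Z q xstar K as
  proof
    have "xstar \<in> D" using minimizer domain(2) by (auto simp: is_arg_min_def)
    then show "\<exists>\<delta>>0. \<forall>x. norm (x - xstar) < \<delta> \<longrightarrow>
        \<bar>Z x - Z xstar - q (x - xstar) / 2\<bar> \<le> \<epsilon> * (norm (x - xstar))\<^sup>2" if "\<epsilon> > 0" for \<epsilon>
      unfolding q_def using second_order_Taylor_Peano domain(1) smooth optimality(1) that by blast
    show "q v = (\<Sum>a\<leftarrow>as. (a \<bullet> v)\<^sup>2)" for v by (rule as)
    show "q K > 0"
      using optimality(2) nondegeneracy unfolding positive_semidefinite_def q_def
      by (simp add: order_less_le)
    show "(\<lambda>\<omega>. Z (sol n l \<omega>)) \<in> borel_measurable M" if "n \<ge> 1" for n l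
    proof -
      have [measurable]: "sol n l \<in> borel_measurable M"
        unfolding sol_def using that by (rule xsol_random_vector)
      have "continuous_on D Z"
        using smooth unfolding twice_differentiable_on_def
        by (intro continuous_at_imp_continuous_on) (auto intro: differentiable_imp_continuous_within)
      \<comment> \<open>\<open>Z\<close> is known to be continuous only on \<open>D\<close>. Its
        extension by 0 is Borel and agrees with \<open>Z\<close> at the solutions, which take values
        in \<open>D\<close>.\<close>
      then have [measurable]: "(\<lambda>x. indicator D x *\<^sub>R Z x) \<in> borel_measurable borel"
        using domain(1) by (intro borel_measurable_continuous_on_indicator) auto
      have "(\<lambda>\<omega>. indicator D (sol n l \<omega>) *\<^sub>R Z (sol n l \<omega>)) \<in> borel_measurable M"
        by (rule measurable_compose[OF _ \<open>(\<lambda>x. indicator D x *\<^sub>R Z x) \<in> borel_measurable borel\<close>]) measurable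
      then show ?thesis
        by (rule measurable_cong[THEN iffD1, rotated]) (simp add: sol_def xsol_domain[OF that])
    qed
    fix ls :: "nat \<Rightarrow> real" assume ls: "ls \<longlonglongrightarrow> 0"
    \<comment> \<open>Dividing by this rate gives \<open>e\<close>. Since
      \<open>sqrt n * b n = 1 + |sqrt n * ls n|\<close>, scaling the expansion by
      \<open>sqrt n\<close> produces the factor in front of \<open>e\<close>.\<close>
    define b where "b n = 1 / sqrt (real n) + \<bar>ls n\<bar>" for n
    define e where "e n \<omega> = linear_remainder P \<xi> xsol xstar IF K n (ls n) \<omega> /\<^sub>R b n" for n \<omega>
    have meas: "e n \<in> borel_measurable M" if "n \<ge> 1" for n
    proof -
      have [measurable]: "sol n (ls n) \<in> borel_measurable M"
        unfolding sol_def using that by (rule xsol_random_vector)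
      have "(\<lambda>\<omega>. (sol n (ls n) \<omega> - xstar - ((1 / sqrt (real n)) *\<^sub>R normalized_sum n \<omega> + ls n *\<^sub>R K))
          /\<^sub>R b n) \<in> borel_measurable M"
        by measurable
      then show ?thesis
        by (rule measurable_cong[THEN iffD1, rotated])
          (simp add: e_def linear_remainder_def sol_def pairing[OF that])
    qed
    have eq: "sqrt (real n) *\<^sub>R (sol n (ls n) \<omega> - xstar) = normalized_sum n \<omega> +
        (sqrt (real n) * ls n) *\<^sub>R K + (1 + \<bar>sqrt (real n) * ls n\<bar>) *\<^sub>R e n \<omega>"
      if "n \<ge> 1" "\<omega> \<in> space M" for n \<omega>
    proof -
      have "b n > 0" using \<open>n \<ge> 1\<close> by (simp add: b_def add_pos_nonneg)
      then have "sol n (ls n) \<omega> - xstar =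
          (1 / sqrt (real n)) *\<^sub>R normalized_sum n \<omega> + ls n *\<^sub>R K + b n *\<^sub>R e n \<omega>"
        by (simp add: e_def linear_remainder_def sol_def pairing[OF that])
      moreover have "sqrt (real n) * b n = 1 + \<bar>sqrt (real n) * ls n\<bar>"
        using \<open>n \<ge> 1\<close> by (simp add: b_def distrib_left abs_mult)
      ultimately show ?thesis
        using \<open>n \<ge> 1\<close> by (simp add: scaleR_add_right)
    qed
    have "\<forall>\<delta>>0. (\<lambda>n. prob {\<omega> \<in> space M. norm (e n \<omega>) > \<delta>}) \<longlonglongrightarrow> 0"
      using linearizability[OF ls] unfolding small_o_prob_def e_def b_def .
    with meas eq show "\<exists>e. (\<forall>n\<ge>1. e n \<in> borel_measurable M) \<and>
      (\<forall>n\<ge>1. \<forall>\<omega>\<in>space M. sqrt (real n) *\<^sub>R (sol n (ls n) \<omega> - xstar) = normalized_sum n \<omega> +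
        (sqrt (real n) * ls n) *\<^sub>R K + (1 + \<bar>sqrt (real n) * ls n\<bar>) *\<^sub>R e n \<omega>) \<and>
      (\<forall>\<delta>>0. (\<lambda>n. prob {\<omega> \<in> space M. norm (e n \<omega>) > \<delta>}) \<longlonglongrightarrow> 0)"
      by blast
  qed
  \<comment> \<open>The solution at 0 is identified with \<open>xEO\<close> only on the sample
    space, so weak limits are transferred instead of the functions being equated.\<close>
  have "real n * (Z (xEO (empirical P \<xi> n \<omega>)) - Z xstar) = gap (\<lambda>_. 0) n \<omega>"
    if "\<omega> \<in> space M" for n \<omega>
    using xsol_0[OF _ that, of n] by (cases "n = 0") (simp_all add: gap_def sol_def)
  then have A: "converges_weakly M (\<lambda>k \<omega>. real (r k) * (Z (xEO (empirical P \<xi> (r k) \<omega>)) - Z xstar)) W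
      \<longleftrightarrow> converges_weakly M (\<lambda>k. gap (\<lambda>_. 0) (r k)) W" for r W
    by (rule weak_limit_cong)
  have B: "(\<lambda>n \<omega>. real n * (Z (xsol (empirical P \<xi> n \<omega>) (lam n)) - Z xstar)) = gap lam"
    by (simp add: gap_def[abs_def] sol_def)
  show ?thesis
    using unperturbed_gap_dominated[OF \<open>lam \<longlonglongrightarrow> 0\<close>]
    unfolding B asymp_ssd_dominated_def by (simp only: A)
qed

end
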